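(* Let $\mathcal{T}$ be a triangulated category with a Serre functor $\mathbb{S}$. Any almost complete $2$-cluster tilting subcategory $\mathcal{D}$ of $\mathcal{T}$ is contained in exactly two $2$-cluster tilting subcategories $\mathcal{X}$ and $\mathcal{Y}$ of $\mathcal{T}$. Both $(\mathcal{X},\mathcal{Y})$ and $(\mathcal{Y},\mathcal{X})$ form $\mathcal{D}$-mutation pairs.
   Context: Conventions: $k$ is a fixed field; all additive categories are Krull-Schmidt; triangulated categories are $k$-linear with finite-dimensional Hom-spaces and shift $[1]$. A subcategory means a full subcategory closed under isomorphisms, direct sums and direct summands (not necessarily under $[1]$). $\mathrm{ind}\,\mathcal{C}$ is the set of isoclasses of indecomposable objects. $(\mathcal{X},\mathcal{Y})=0$ means all morphisms from objects of $\mathcal X$ to objects of $\mathcal Y$ vanish; $\mathcal{X}^\perp=\{T\mid(\mathcal{X},T)=0\}$, ${}^\perp\mathcal{X}=\{T\mid (T,\mathcal{X})=0\}$. $\mathcal{X}*\mathcal{Y}$ is the collection of $T$ admitting a triangle $X\to T\to Y\to X[1]$ with $X\in\mathcal{X}$, $Y\in\mathcal{Y}$. A Serre functor is a $k$-linear autofunctor $\mathbb{S}$ with functorial isomorphisms $(X,Y)\simeq D(Y,\mathbb{S}X)$, $D$ the $k$-dual. $\mathbb{S}_2=\mathbb{S}\circ[-2]$; an $\mathbb{S}_2$-subcategory is a subcategory $\mathcal{C}$ with $\mathcal{C}=\mathbb{S}_2\mathcal{C}=\mathbb{S}_2^{-1}\mathcal{C}$. $\mathcal{C}$ is $2$-rigid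 if $(\mathcal{C},\mathcal{C}[1])=0$. A subcategory $\mathcal C$ is functorially finite if every object $T$ has a right $\mathcal{C}$-approximation ($X\to T$ with $X\in\mathcal{C}$ and $(-,X)\to(-,T)$ surjective on $\mathcal{C}$) and dually a left $\mathcal{C}$-approximation. A functorially finite $\mathcal{C}$ is $2$-cluster tilting if $\mathcal{C}=\mathcal{C}[-1]^\perp={}^\perp\mathcal{C}[1]$ (such $\mathcal C$ is automatically an $\mathbb S_2$-subcategory). A functorially finite $2$-rigid $\mathbb{S}_2$-subcategory $\mathcal{D}$ is almost complete $2$-cluster tilting if there is a $2$-cluster tilting subcategory $\mathcal{C}\supset\mathcal{D}$ such that $\mathrm{ind}\,\mathcal{C}-\mathrm{ind}\,\mathcal{D}$ consists of a single $\mathbb{S}_2$-orbit. For $\mathcal{D}$ with $(\mathcal{D},\mathcal{D}[1])=0$, put $\mu^{-1}(\mathcal{X};\mathcal{D})=(\mathcal{D}*\mathcal{X}[1])\cap{}^\perp\mathcal{D}[1]$ and $\mu(\mathcal{Y};\mathcal{D})=(\mathcal{Y}[-1]*\mathcal{D})\cap\mathcal{D}[-1]^\perp$. A pair $(\mathcal{X},\mathcal{Y})$ of subcategories is a $\mathcal{D}$-mutation pair if $\mathcal{D}\subset\mathcal{Y}\subset\mu^{-1}(\mathcal{X};\mathcal{D})$ and $\mathcal{D}\subset\mathcal{X}\subset\mu(\mathcal{Y};\mathcal{D})$. *)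

theory Defs
  imports Complex_Main "HOL-Library.FuncSet"
begin

section \<open>Linear categories\<close>

text \<open>
  The objects of a category are all elements of the type \<open>'o\<close>. The Hom-spaces are subspaces of one
  ambient \<open>'k\<close>-vector space \<open>'m\<close>, so that the library's vector space notions apply to them. This is no
  restriction: every \<open>'k\<close>-linear category with object type \<open>'o\<close> has this form, with \<open>'m\<close> the direct
  sum of all its Hom-spaces and composition extended bilinearly. Hom-spaces may overlap (they
  all contain \<open>0\<close>), hence source and target are always mentioned separately from the morphism.
  Composition is written in the usual order: \<open>g \<cdot> f\<close> is \<open>f\<close> followed by \<open>g\<close>.
\<close>

record ('k, 'o, 'm) lin_cat =
  scal :: "'k \<Rightarrow> 'm \<Rightarrow> 'm"
  Hom :: "'o \<Rightarrow> 'o \<Rightarrow> 'm set"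
  ccomp :: "'m \<Rightarrow> 'm \<Rightarrow> 'm" (infixl \<open>\<cdot>\<index>\<close> 70)
  idm :: "'o \<Rightarrow> 'm"

locale linear_category =
  fixes C :: "('k::field, 'o, 'm::ab_group_add, 'z) lin_cat_scheme" (structure)
  assumes vector_space: "vector_space (scal C)"
    and subspace_Hom: "module.subspace (scal C) (Hom C X Y)"
    and idm_in_Hom: "idm C X \<in> Hom C X X"
    and comp_in_Hom: "\<lbrakk>f \<in> Hom C X Y; g \<in> Hom C Y Z\<rbrakk> \<Longrightarrow> g \<cdot> f \<in> Hom C X Z"
    and comp_assoc:
      "\<lbrakk>f \<in> Hom C W X; g \<in> Hom C X Y; h \<in> Hom C Y Z\<rbrakk> \<Longrightarrow> (h \<cdot> g) \<cdot> f = h \<cdot> (g \<cdot> f)"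
    and comp_idm: "f \<in> Hom C X Y \<Longrightarrow> f \<cdot> idm C X = f"
    and idm_comp: "f \<in> Hom C X Y \<Longrightarrow> idm C Y \<cdot> f = f"
    and comp_add_right:
      "\<lbrakk>f \<in> Hom C X Y; f' \<in> Hom C X Y; g \<in> Hom C Y Z\<rbrakk> \<Longrightarrow> g \<cdot> (f + f') = g \<cdot> f + g \<cdot> f'"
    and comp_add_left:
      "\<lbrakk>f \<in> Hom C X Y; g \<in> Hom C Y Z; g' \<in> Hom C Y Z\<rbrakk> \<Longrightarrow> (g + g') \<cdot> f = g \<cdot> f + g' \<cdot> f"
    and comp_scal_right:
      "\<lbrakk>f \<in> Hom C X Y; g \<in> Hom C Y Z\<rbrakk> \<Longrightarrow> g \<cdot> scal C c f = scal C c (g \<cdot> f)"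
    and comp_scal_left:
      "\<lbrakk>f \<in> Hom C X Y; g \<in> Hom C Y Z\<rbrakk> \<Longrightarrow> scal C c g \<cdot> f = scal C c (g \<cdot> f)"

context
  fixes C :: "('k::field, 'o, 'm::ab_group_add, 'z) lin_cat_scheme" (structure)
begin

definition iso :: "'o \<Rightarrow> 'o \<Rightarrow> 'm \<Rightarrow> bool" where
  "iso X Y f \<longleftrightarrow> f \<in> Hom C X Y \<and> (\<exists>g\<in>Hom C Y X. g \<cdot> f = idm C X \<and> f \<cdot> g = idm C Y)"

definition isomorphic :: "'o \<Rightarrow> 'o \<Rightarrow> bool" where
  "isomorphic X Y \<longleftrightarrow> (\<exists>f. iso X Y f)"

definition iso_class :: "'o \<Rightarrow> 'o set" where
  "iso_class X = {Y. isomorphic X Y}"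

definition zero_object :: "'o \<Rightarrow> bool" where
  "zero_object Z \<longleftrightarrow> (\<forall>X. Hom C X Z = {0} \<and> Hom C Z X = {0})"

definition direct_sum :: "'o \<Rightarrow> 'o \<Rightarrow> 'o \<Rightarrow> bool" where
  "direct_sum X Y P \<longleftrightarrow>
    (\<exists>i\<in>Hom C X P. \<exists>j\<in>Hom C Y P. \<exists>p\<in>Hom C P X. \<exists>q\<in>Hom C P Y.
      p \<cdot> i = idm C X \<and> q \<cdot> j = idm C Y \<and> p \<cdot> j = 0 \<and> q \<cdot> i = 0 \<and> i \<cdot> p + j \<cdot> q = idm C P)"

primrec direct_sum_list :: "'o list \<Rightarrow> 'o \<Rightarrow> bool" where
  "direct_sum_list [] P \<longleftrightarrow> zero_object P"
| "direct_sum_list (X # Xs) P \<longleftrightarrow> (\<exists>Q. direct_sum_list Xs Q \<and> direct_sum X Q P)"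

definition indecomposable :: "'o \<Rightarrow> bool" where
  "indecomposable X \<longleftrightarrow>
    \<not> zero_object X \<and> (\<forall>Y Z. direct_sum Y Z X \<longrightarrow> zero_object Y \<or> zero_object Z)"

text \<open>The endomorphism ring is local: it is nonzero and its non-units are closed under addition.\<close>

definition local_End :: "'o \<Rightarrow> bool" where
  "local_End X \<longleftrightarrow> idm C X \<noteq> 0 \<and>
    (\<forall>f\<in>Hom C X X. \<forall>g\<in>Hom C X X. \<not> iso X X f \<and> \<not> iso X X g \<longrightarrow> \<not> iso X X (f + g))"

definition krull_schmidt :: bool where
  "krull_schmidt \<longleftrightarrow> (\<forall>X. \<exists>Xs. direct_sum_list Xs X \<and> (\<forall>Y\<in>set Xs. local_End Y))"

definition hom_finite :: bool where
  "hom_finite \<longleftrightarrow> (\<forall>X Y. \<exists>B. finite B \<and> B \<subseteq> Hom C X Y \<and> module.span (scal C) B = Hom C X Y)"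

end

locale additive_category = linear_category +
  assumes ex_zero_object: "\<exists>Z. zero_object C Z"
    and ex_direct_sum: "\<exists>P. direct_sum C X Y P"


section \<open>Endofunctors\<close>

record ('o, 'm) endofunctor =
  ob :: "'o \<Rightarrow> 'o"
  mor :: "'m \<Rightarrow> 'm"

definition id_functor :: "('o, 'm) endofunctor" where
  "id_functor = \<lparr>ob = (\<lambda>X. X), mor = (\<lambda>f. f)\<rparr>"

definition functor_comp ::
    "('o, 'm) endofunctor \<Rightarrow> ('o, 'm) endofunctor \<Rightarrow> ('o, 'm) endofunctor"
    (infixr \<open>\<odot>\<close> 75) where
  "F \<odot> G = \<lparr>ob = (\<lambda>X. ob F (ob G X)), mor = (\<lambda>f. mor F (mor G f))\<rparr>"

context
  fixes C :: "('k::field, 'o, 'm::ab_group_add, 'z) lin_cat_scheme" (structure)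
begin

definition linear_functor :: "('o, 'm) endofunctor \<Rightarrow> bool" where
  "linear_functor F \<longleftrightarrow>
    (\<forall>X Y. \<forall>f\<in>Hom C X Y. mor F f \<in> Hom C (ob F X) (ob F Y)) \<and>
    (\<forall>X. mor F (idm C X) = idm C (ob F X)) \<and>
    (\<forall>X Y Z. \<forall>f\<in>Hom C X Y. \<forall>g\<in>Hom C Y Z. mor F (g \<cdot> f) = mor F g \<cdot> mor F f) \<and>
    (\<forall>X Y. \<forall>f\<in>Hom C X Y. \<forall>g\<in>Hom C X Y. mor F (f + g) = mor F f + mor F g) \<and>
    (\<forall>X Y c. \<forall>f\<in>Hom C X Y. mor F (scal C c f) = scal C c (mor F f))"

definition naturally_isomorphic ::
    "('o, 'm) endofunctor \<Rightarrow> ('o, 'm) endofunctor \<Rightarrow> bool" where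
  "naturally_isomorphic F G \<longleftrightarrow>
    (\<exists>\<alpha>. (\<forall>X. iso C (ob F X) (ob G X) (\<alpha> X)) \<and>
      (\<forall>X Y. \<forall>f\<in>Hom C X Y. \<alpha> Y \<cdot> mor F f = mor G f \<cdot> \<alpha> X))"

definition quasi_inverse :: "('o, 'm) endofunctor \<Rightarrow> ('o, 'm) endofunctor \<Rightarrow> bool" where
  "quasi_inverse F G \<longleftrightarrow> linear_functor F \<and> linear_functor G \<and>
    naturally_isomorphic (G \<odot> F) id_functor \<and> naturally_isomorphic (F \<odot> G) id_functor"

text \<open>The subcategory \<open>F\<C>\<close>, i.e. the closure under isomorphism of the objects \<open>F X\<close> with \<open>X \<in> \<C>\<close>.\<close>

definition functor_image :: "('o, 'm) endofunctor \<Rightarrow> 'o set \<Rightarrow> 'o set" where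
  "functor_image F \<C> = {T. \<exists>X\<in>\<C>. isomorphic C (ob F X) T}"


section \<open>Subcategories\<close>

text \<open>
  Full subcategories are given by their sets of objects. Finite direct sums include the empty one.
\<close>

definition subcategory :: "'o set \<Rightarrow> bool" where
  "subcategory \<C> \<longleftrightarrow>
    (\<forall>X Y. X \<in> \<C> \<and> isomorphic C X Y \<longrightarrow> Y \<in> \<C>) \<and>
    (\<forall>Z. zero_object C Z \<longrightarrow> Z \<in> \<C>) \<and>
    (\<forall>X Y P. direct_sum C X Y P \<and> X \<in> \<C> \<and> Y \<in> \<C> \<longrightarrow> P \<in> \<C>) \<and>
    (\<forall>X Y P. direct_sum C X Y P \<and> P \<in> \<C> \<longrightarrow> X \<in> \<C> \<and> Y \<in> \<C>)"

definition ind :: "'o set \<Rightarrow> 'o set set" where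
  "ind \<C> = {iso_class C X | X. X \<in> \<C> \<and> indecomposable C X}"

definition hom_orthogonal :: "'o set \<Rightarrow> 'o set \<Rightarrow> bool" where
  "hom_orthogonal \<X> \<Y> \<longleftrightarrow> (\<forall>X\<in>\<X>. \<forall>Y\<in>\<Y>. Hom C X Y = {0})"

definition right_perp :: "'o set \<Rightarrow> 'o set" where
  "right_perp \<X> = {T. hom_orthogonal \<X> {T}}"

definition left_perp :: "'o set \<Rightarrow> 'o set" where
  "left_perp \<X> = {T. hom_orthogonal {T} \<X>}"

definition right_approximation :: "'o set \<Rightarrow> 'o \<Rightarrow> 'o \<Rightarrow> 'm \<Rightarrow> bool" where
  "right_approximation \<C> T X f \<longleftrightarrow> X \<in> \<C> \<and> f \<in> Hom C X T \<and>
    (\<forall>X'\<in>\<C>. \<forall>g\<in>Hom C X' T. \<exists>h\<in>Hom C X' X. g = f \<cdot> h)"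

definition left_approximation :: "'o set \<Rightarrow> 'o \<Rightarrow> 'o \<Rightarrow> 'm \<Rightarrow> bool" where
  "left_approximation \<C> T X f \<longleftrightarrow> X \<in> \<C> \<and> f \<in> Hom C T X \<and>
    (\<forall>X'\<in>\<C>. \<forall>g\<in>Hom C T X'. \<exists>h\<in>Hom C X X'. g = h \<cdot> f)"

definition functorially_finite :: "'o set \<Rightarrow> bool" where
  "functorially_finite \<C> \<longleftrightarrow>
    (\<forall>T. (\<exists>X f. right_approximation \<C> T X f) \<and> (\<exists>X f. left_approximation \<C> T X f))"

end


section \<open>Triangulated categories\<close>

text \<open>
  The shift is an autoequivalence with a chosen quasi-inverse \<open>unshift\<close>; a strict automorphism is
  a special case. \<open>tri T X Y Z u v w\<close> says that \<open>X \<rightarrow> Y \<rightarrow> Z \<rightarrow> X[1]\<close>, with maps \<open>u\<close>, \<open>v\<close>, \<open>w\<close>, is a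
  distinguished triangle.
\<close>

record ('k, 'o, 'm) tri_cat = "('k, 'o, 'm) lin_cat" +
  shift :: "('o, 'm) endofunctor"
  unshift :: "('o, 'm) endofunctor"
  tri :: "'o \<Rightarrow> 'o \<Rightarrow> 'o \<Rightarrow> 'm \<Rightarrow> 'm \<Rightarrow> 'm \<Rightarrow> bool"

locale triangulated_category = additive_category T
  for T :: "('k::field, 'o, 'm::ab_group_add, 'z) tri_cat_scheme" (structure) +
  assumes shift_unshift: "quasi_inverse T (shift T) (unshift T)"
    and tri_in_Hom: "tri T X Y Z u v w \<Longrightarrow>
      u \<in> Hom T X Y \<and> v \<in> Hom T Y Z \<and> w \<in> Hom T Z (ob (shift T) X)"
    and tri_iso: "\<lbrakk>tri T X Y Z u v w; iso T X X' a; iso T Y Y' b; iso T Z Z' c;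
      u' \<in> Hom T X' Y'; v' \<in> Hom T Y' Z'; w' \<in> Hom T Z' (ob (shift T) X');
      b \<cdot> u = u' \<cdot> a; c \<cdot> v = v' \<cdot> b; mor (shift T) a \<cdot> w = w' \<cdot> c\<rbrakk> \<Longrightarrow>
      tri T X' Y' Z' u' v' w'"
    and tri_idm: "zero_object T Z \<Longrightarrow> tri T X X Z (idm T X) 0 0"
    and ex_tri: "u \<in> Hom T X Y \<Longrightarrow> \<exists>Z v w. tri T X Y Z u v w"
    and tri_rotate: "\<lbrakk>u \<in> Hom T X Y; v \<in> Hom T Y Z; w \<in> Hom T Z (ob (shift T) X)\<rbrakk> \<Longrightarrow>
      tri T X Y Z u v w \<longleftrightarrow> tri T Y Z (ob (shift T) X) v w (- mor (shift T) u)"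
    and tri_morphism: "\<lbrakk>tri T X Y Z u v w; tri T X' Y' Z' u' v' w';
      a \<in> Hom T X X'; b \<in> Hom T Y Y'; b \<cdot> u = u' \<cdot> a\<rbrakk> \<Longrightarrow>
      \<exists>c\<in>Hom T Z Z'. c \<cdot> v = v' \<cdot> b \<and> mor (shift T) a \<cdot> w = w' \<cdot> c"
    and octahedral: "\<lbrakk>tri T X Y Z' u i i'; tri T Y Z X' v j j'; tri T X Z Y' (v \<cdot> u) k k'\<rbrakk> \<Longrightarrow>
      \<exists>f\<in>Hom T Z' Y'. \<exists>g\<in>Hom T Y' X'. tri T Z' Y' X' f g (mor (shift T) i \<cdot> j') \<and>
        f \<cdot> i = k \<cdot> v \<and> k' \<cdot> f = i' \<and> g \<cdot> k = j \<and> j' \<cdot> g = mor (shift T) u \<cdot> k'"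


section \<open>Serre functors\<close>

text \<open>The dual of the subspace \<open>V\<close>; functionals are taken to be undefined outside \<open>V\<close>.\<close>

definition dual_space :: "('k::field \<Rightarrow> 'm::ab_group_add \<Rightarrow> 'm) \<Rightarrow> 'm set \<Rightarrow> ('m \<Rightarrow> 'k) set" where
  "dual_space sc V = {\<phi> \<in> extensional V.
    (\<forall>f\<in>V. \<forall>g\<in>V. \<phi> (f + g) = \<phi> f + \<phi> g) \<and> (\<forall>c. \<forall>f\<in>V. \<phi> (sc c f) = c * \<phi> f)}"

context
  fixes T :: "('k::field, 'o, 'm::ab_group_add, 'z) tri_cat_scheme" (structure)
begin

text \<open>
  \<open>\<eta> X Y\<close> is the isomorphism from \<open>(X, Y)\<close> to \<open>D(Y, SX)\<close>. The last two clauses express that it is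
  natural in \<open>Y\<close> and in \<open>X\<close>, respectively.
\<close>

definition serre_functor :: "('o, 'm) endofunctor \<Rightarrow> ('o, 'm) endofunctor \<Rightarrow> bool" where
  "serre_functor S S' \<longleftrightarrow> quasi_inverse T S S' \<and>
    (\<exists>\<eta> :: 'o \<Rightarrow> 'o \<Rightarrow> 'm \<Rightarrow> 'm \<Rightarrow> 'k.
      (\<forall>X Y. bij_betw (\<eta> X Y) (Hom T X Y) (dual_space (scal T) (Hom T Y (ob S X)))) \<and>
      (\<forall>X Y. \<forall>f\<in>Hom T X Y. \<forall>g\<in>Hom T X Y. \<forall>h\<in>Hom T Y (ob S X).
        \<eta> X Y (f + g) h = \<eta> X Y f h + \<eta> X Y g h) \<and>
      (\<forall>X Y c. \<forall>f\<in>Hom T X Y. \<forall>h\<in>Hom T Y (ob S X). \<eta> X Y (scal T c f) h = c * \<eta> X Y f h) \<and>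
      (\<forall>X Y Y'. \<forall>f\<in>Hom T X Y. \<forall>b\<in>Hom T Y Y'. \<forall>h\<in>Hom T Y' (ob S X).
        \<eta> X Y' (b \<cdot> f) h = \<eta> X Y f (h \<cdot> b)) \<and>
      (\<forall>X X' Y. \<forall>f\<in>Hom T X Y. \<forall>a\<in>Hom T X' X. \<forall>h\<in>Hom T Y (ob S X').
        \<eta> X' Y (f \<cdot> a) h = \<eta> X Y f (mor S a \<cdot> h)))"

definition S2 :: "('o, 'm) endofunctor \<Rightarrow> ('o, 'm) endofunctor" where
  "S2 S = S \<odot> unshift T \<odot> unshift T"

text \<open>The quasi-inverse of \<open>S2 S\<close>, where \<open>S'\<close> is the quasi-inverse of \<open>S\<close>.\<close>

definition S2_inv :: "('o, 'm) endofunctor \<Rightarrow> ('o, 'm) endofunctor" where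
  "S2_inv S' = shift T \<odot> shift T \<odot> S'"

definition S2_subcategory ::
    "('o, 'm) endofunctor \<Rightarrow> ('o, 'm) endofunctor \<Rightarrow> 'o set \<Rightarrow> bool" where
  "S2_subcategory S S' \<C> \<longleftrightarrow> subcategory T \<C> \<and>
    \<C> = functor_image T (S2 S) \<C> \<and> \<C> = functor_image T (S2_inv S') \<C>"

definition S2_orbit ::
    "('o, 'm) endofunctor \<Rightarrow> ('o, 'm) endofunctor \<Rightarrow> 'o \<Rightarrow> 'o set set" where
  "S2_orbit S S' X =
    {iso_class T ((ob (S2 S) ^^ n) X) | n. True} \<union> {iso_class T ((ob (S2_inv S') ^^ n) X) | n. True}"


section \<open>Cluster tilting and mutation\<close>

definition star :: "'o set \<Rightarrow> 'o set \<Rightarrow> 'o set" where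
  "star \<X> \<Y> = {A. \<exists>X\<in>\<X>. \<exists>Y\<in>\<Y>. \<exists>u v w. tri T X A Y u v w}"

definition two_rigid :: "'o set \<Rightarrow> bool" where
  "two_rigid \<C> \<longleftrightarrow> hom_orthogonal T \<C> (functor_image T (shift T) \<C>)"

definition two_cluster_tilting :: "'o set \<Rightarrow> bool" where
  "two_cluster_tilting \<C> \<longleftrightarrow> subcategory T \<C> \<and> functorially_finite T \<C> \<and>
    \<C> = right_perp T (functor_image T (unshift T) \<C>) \<and>
    \<C> = left_perp T (functor_image T (shift T) \<C>)"

definition almost_complete_two_cluster_tilting ::
    "('o, 'm) endofunctor \<Rightarrow> ('o, 'm) endofunctor \<Rightarrow> 'o set \<Rightarrow> bool" where
  "almost_complete_two_cluster_tilting S S' \<D> \<longleftrightarrow>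
    functorially_finite T \<D> \<and> two_rigid \<D> \<and> S2_subcategory S S' \<D> \<and>
    (\<exists>\<C>. two_cluster_tilting \<C> \<and> \<D> \<subseteq> \<C> \<and>
      (\<exists>X. indecomposable T X \<and> ind T \<C> - ind T \<D> = S2_orbit S S' X))"

definition mu_inv :: "'o set \<Rightarrow> 'o set \<Rightarrow> 'o set" where
  "mu_inv \<X> \<D> =
    star \<D> (functor_image T (shift T) \<X>) \<inter> left_perp T (functor_image T (shift T) \<D>)"

definition mu :: "'o set \<Rightarrow> 'o set \<Rightarrow> 'o set" where
  "mu \<Y> \<D> =
    star (functor_image T (unshift T) \<Y>) \<D> \<inter> right_perp T (functor_image T (unshift T) \<D>)"

definition mutation_pair :: "'o set \<Rightarrow> 'o set \<Rightarrow> 'o set \<Rightarrow> bool" where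
  "mutation_pair \<D> \<X> \<Y> \<longleftrightarrow> subcategory T \<D> \<and> two_rigid \<D> \<and> subcategory T \<X> \<and> subcategory T \<Y> \<and>
    \<D> \<subseteq> \<Y> \<and> \<Y> \<subseteq> mu_inv \<X> \<D> \<and> \<D> \<subseteq> \<X> \<and> \<X> \<subseteq> mu \<Y> \<D>"

end

end

theory Submission
  imports Defs
begin

text \<open>
  Put \<open>\<Z> = \<D>[-1]\<^sup>\<bottom>\<close>, which is \<open>\<^sup>\<bottom>\<D>[1]\<close> by Serre duality. Triangles \<open>A \<rightarrow> D \<rightarrow> B \<rightarrow> A[1]\<close> with
  \<open>A, B \<in> \<Z>\<close> and \<open>D \<in> \<D>\<close> define mutually inverse shifts on \<open>\<Z>/[\<D>]\<close>. They preserve vanishing of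
  extensions, so they send 2-cluster tilting subcategories containing \<open>\<D>\<close> to such subcategories.

  Let \<open>\<C> \<supseteq> \<D>\<close> be 2-cluster tilting with a single additional orbit, and let \<open>\<Y> \<subseteq> \<Z>\<close> satisfy
  \<open>\<Y> = \<Y>[-1]\<^sup>\<bottom> = \<^sup>\<bottom>\<Y>[1]\<close>. Take triangles \<open>C1 \<rightarrow> C0 \<rightarrow> A \<rightarrow> C1[1]\<close> with \<open>A \<in> \<Y>\<close> and \<open>C0 \<rightarrow> A\<close> a minimal
  right \<open>\<C>\<close>-approximation. Rigidity of \<open>\<Y>\<close> forbids a common summand of the \<open>C1\<close> of one object and the
  \<open>C0\<close> of another, and the summands of the various \<open>C0\<close> are closed under \<open>S\<^sub>2\<close>. As there is just one
  orbit outside \<open>\<D>\<close>, either all \<open>C1\<close> lie in \<open>\<D>\<close>, whence \<open>\<Y> \<subseteq> \<C>\<close>, or all \<open>C0\<close> lie in \<open>\<D>\<close>, whence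
  \<open>\<Y> \<subseteq> \<C>\<langle>1\<rangle>\<close>. For \<open>\<Y> = \<C>\<langle>-1\<rangle>\<close> this gives \<open>\<C>\<langle>-1\<rangle> = \<C>\<langle>1\<rangle>\<close>, hence both mutation pairs.
\<close>

section \<open>Linear categories\<close>

context linear_category
begin

lemma zero_in_Hom [simp]: "0 \<in> Hom C X Y"
proof -
  interpret vector_space "scal C" by (rule vector_space)
  show ?thesis using subspace_Hom subspace_0 by blast
qed

lemma add_in_Hom: "f \<in> Hom C X Y \<Longrightarrow> g \<in> Hom C X Y \<Longrightarrow> f + g \<in> Hom C X Y"
proof -
  interpret vector_space "scal C" by (rule vector_space)
  show "f \<in> Hom C X Y \<Longrightarrow> g \<in> Hom C X Y \<Longrightarrow> f + g \<in> Hom C X Y"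
    using subspace_Hom subspace_add by blast
qed

lemma uminus_in_Hom: "f \<in> Hom C X Y \<Longrightarrow> - f \<in> Hom C X Y"
proof -
  interpret vector_space "scal C" by (rule vector_space)
  show "f \<in> Hom C X Y \<Longrightarrow> - f \<in> Hom C X Y" using subspace_Hom subspace_neg by blast
qed

lemma diff_in_Hom: "f \<in> Hom C X Y \<Longrightarrow> g \<in> Hom C X Y \<Longrightarrow> f - g \<in> Hom C X Y"
  using add_in_Hom[of f X Y "- g"] uminus_in_Hom by simp

lemma comp_zero_right: "g \<in> Hom C Y Z \<Longrightarrow> g \<cdot> 0 = 0"
  using comp_add_right[of 0 Y Y 0 g Z] by simp

lemma comp_zero_left: "f \<in> Hom C X Y \<Longrightarrow> 0 \<cdot> f = 0"
  using comp_add_left[of f X Y 0 Y 0] by simp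

lemma comp_uminus_right: "f \<in> Hom C X Y \<Longrightarrow> g \<in> Hom C Y Z \<Longrightarrow> g \<cdot> (- f) = - (g \<cdot> f)"
  using comp_add_right[of f X Y "- f" g Z] uminus_in_Hom[of f X Y] comp_zero_right[of g Y Z]
  by (simp add: eq_neg_iff_add_eq_0 add.commute)

lemma comp_uminus_left: "f \<in> Hom C X Y \<Longrightarrow> g \<in> Hom C Y Z \<Longrightarrow> (- g) \<cdot> f = - (g \<cdot> f)"
  using comp_add_left[of f X Y g Z "- g"] uminus_in_Hom[of g Y Z] comp_zero_left[of f X Y]
  by (simp add: eq_neg_iff_add_eq_0 add.commute)

lemma comp_diff_right:
  "f \<in> Hom C X Y \<Longrightarrow> f' \<in> Hom C X Y \<Longrightarrow> g \<in> Hom C Y Z \<Longrightarrow> g \<cdot> (f - f') = g \<cdot> f - g \<cdot> f'"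
  using comp_add_right[of f X Y "- f'" g Z] uminus_in_Hom[of f' X Y] comp_uminus_right[of f' X Y g Z]
  by simp

lemma split_epi_cancel:
  assumes "a \<in> Hom C W X" "b \<in> Hom C X W" "a \<cdot> b = idm C X"
    and "f \<in> Hom C X Y" "g \<in> Hom C X Y" "f \<cdot> a = g \<cdot> a"
  shows "f = g"
proof -
  have "f = (f \<cdot> a) \<cdot> b" unfolding comp_assoc[OF assms(2,1,4)] assms(3) comp_idm[OF assms(4)] ..
  also have "\<dots> = g"
    unfolding assms(6) comp_assoc[OF assms(2,1,5)] assms(3) comp_idm[OF assms(5)] ..
  finally show ?thesis .
qed

lemma split_mono_cancel:
  assumes "a \<in> Hom C Y Z" "b \<in> Hom C Z Y" "b \<cdot> a = idm C Y"
    and "f \<in> Hom C X Y" "g \<in> Hom C X Y" "a \<cdot> f = a \<cdot> g"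
  shows "f = g"
proof -
  have "f = b \<cdot> (a \<cdot> f)" unfolding comp_assoc[OF assms(4,1,2), symmetric] assms(3) idm_comp[OF assms(4)] ..
  also have "\<dots> = g"
    unfolding assms(6) comp_assoc[OF assms(5,1,2), symmetric] assms(3) idm_comp[OF assms(5)] ..
  finally show ?thesis .
qed

section \<open>Isomorphisms, retracts and zero objects\<close>

lemma isoI:
  "f \<in> Hom C X Y \<Longrightarrow> g \<in> Hom C Y X \<Longrightarrow> g \<cdot> f = idm C X \<Longrightarrow> f \<cdot> g = idm C Y \<Longrightarrow> iso C X Y f"
  unfolding iso_def by blast

lemma isoE:
  assumes "iso C X Y f"
  obtains g where "f \<in> Hom C X Y" "g \<in> Hom C Y X" "g \<cdot> f = idm C X" "f \<cdot> g = idm C Y" "iso C Y X g"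
  using assms unfolding iso_def by blast

lemma iso_idm: "iso C X X (idm C X)"
  by (rule isoI[OF idm_in_Hom idm_in_Hom comp_idm[OF idm_in_Hom] comp_idm[OF idm_in_Hom]])

lemma iso_comp:
  assumes "iso C X Y f" "iso C Y Z g"
  shows "iso C X Z (g \<cdot> f)"
proof -
  obtain f' where f: "f \<in> Hom C X Y" "f' \<in> Hom C Y X" "f' \<cdot> f = idm C X" "f \<cdot> f' = idm C Y"
    using assms(1) by (rule isoE)
  obtain g' where g: "g \<in> Hom C Y Z" "g' \<in> Hom C Z Y" "g' \<cdot> g = idm C Y" "g \<cdot> g' = idm C Z"
    using assms(2) by (rule isoE)
  have "(f' \<cdot> g') \<cdot> (g \<cdot> f) = idm C X"
    using comp_assoc[OF comp_in_Hom[OF f(1) g(1)] g(2) f(2)] comp_assoc[OF f(1) g(1,2)]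
      idm_comp[OF f(1)] f(3) g(3) by simp
  moreover have "(g \<cdot> f) \<cdot> (f' \<cdot> g') = idm C Z"
    using comp_assoc[OF comp_in_Hom[OF g(2) f(2)] f(1) g(1)] comp_assoc[OF g(2) f(2,1)]
      idm_comp[OF g(2)] f(4) g(4) by simp
  ultimately show ?thesis
    by (intro isoI[of _ _ _ "f' \<cdot> g'"] comp_in_Hom[OF f(1) g(1)] comp_in_Hom[OF g(2) f(2)])
qed

lemma isomorphic_refl: "isomorphic C X X"
  unfolding isomorphic_def using iso_idm by blast

lemma isomorphic_sym: "isomorphic C X Y \<Longrightarrow> isomorphic C Y X"
  unfolding isomorphic_def iso_def by blast

lemma iso_class_eqD: "iso_class C X = iso_class C Y \<Longrightarrow> isomorphic C X Y"
  unfolding iso_class_def using isomorphic_refl by blast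

lemma Hom_eq_zero_iff: "Hom C X Y = {0} \<longleftrightarrow> (\<forall>f\<in>Hom C X Y. f = 0)"
  using zero_in_Hom by blast

text \<open>Direct summands are handled as retracts, which avoids naming a complement;
  \<open>retract_complement\<close> recovers one in a triangulated category.\<close>

definition retract where
  "retract W X \<longleftrightarrow> (\<exists>i\<in>Hom C W X. \<exists>p\<in>Hom C X W. p \<cdot> i = idm C W)"

lemma retractE:
  assumes "retract W X"
  obtains i p where "i \<in> Hom C W X" "p \<in> Hom C X W" "p \<cdot> i = idm C W"
  using assms unfolding retract_def by blast

lemma retract_trans:
  assumes "retract V W" "retract W X"
  shows "retract V X"
proof -
  obtain i p where ip: "i \<in> Hom C V W" "p \<in> Hom C W V" "p \<cdot> i = idm C V"
    using assms(1) by (rule retractE)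
  obtain j q where jq: "j \<in> Hom C W X" "q \<in> Hom C X W" "q \<cdot> j = idm C W"
    using assms(2) by (rule retractE)
  have "(p \<cdot> q) \<cdot> (j \<cdot> i) = idm C V"
    using comp_assoc[OF comp_in_Hom[OF ip(1) jq(1)] jq(2) ip(2)] comp_assoc[OF ip(1) jq(1,2)]
      idm_comp[OF ip(1)] ip(3) jq(3) by simp
  then show ?thesis
    unfolding retract_def using comp_in_Hom[OF ip(1) jq(1)] comp_in_Hom[OF jq(2) ip(2)] by blast
qed

lemma isomorphic_imp_retract: "isomorphic C X Y \<Longrightarrow> retract X Y"
  unfolding isomorphic_def retract_def iso_def by blast

lemma direct_sum_imp_retract:
  assumes "direct_sum C X Y P"
  shows "retract X P" "retract Y P"
  using assms unfolding direct_sum_def retract_def by blast+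

lemma retract_zero:
  assumes "Hom C X Y = {0}" "retract X' X" "retract Y' Y"
  shows "Hom C X' Y' = {0}"
proof -
  obtain i p where ip: "i \<in> Hom C X' X" "p \<in> Hom C X X'" "p \<cdot> i = idm C X'"
    using assms(2) by (rule retractE)
  obtain j q where jq: "j \<in> Hom C Y' Y" "q \<in> Hom C Y Y'" "q \<cdot> j = idm C Y'"
    using assms(3) by (rule retractE)
  have "f = 0" if f: "f \<in> Hom C X' Y'" for f
  proof -
    have jfp: "j \<cdot> (f \<cdot> p) = 0"
      using assms(1) comp_in_Hom[OF comp_in_Hom[OF ip(2) f] jq(1)] by blast
    have "f \<cdot> p = q \<cdot> (j \<cdot> (f \<cdot> p))"
      using comp_assoc[OF comp_in_Hom[OF ip(2) f] jq(1,2)] idm_comp[OF comp_in_Hom[OF ip(2) f]] jq(3)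
      by simp
    then have "f \<cdot> p = 0" using jfp comp_zero_right[OF jq(2)] by simp
    then show "f = 0"
      using comp_assoc[OF ip(1,2) f] comp_idm[OF f] ip(3) comp_zero_left[OF ip(1)] by simp
  qed
  then show ?thesis unfolding Hom_eq_zero_iff by blast
qed

lemma isomorphic_Hom_zero:
  "isomorphic C X X' \<Longrightarrow> isomorphic C Y Y' \<Longrightarrow> Hom C X Y = {0} \<longleftrightarrow> Hom C X' Y' = {0}"
  using retract_zero isomorphic_imp_retract isomorphic_sym by blast

lemma zero_object_iff: "zero_object C Z \<longleftrightarrow> idm C Z = 0"
proof
  show "zero_object C Z \<Longrightarrow> idm C Z = 0"
    unfolding zero_object_def using idm_in_Hom by blast
  assume *: "idm C Z = 0"
  have "f = 0" if "f \<in> Hom C X Z" for f X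
    using idm_comp[OF that] comp_zero_left[OF that] * by simp
  moreover have "f = 0" if "f \<in> Hom C Z X" for f X
    using comp_idm[OF that] comp_zero_right[OF that] * by simp
  ultimately show "zero_object C Z"
    unfolding zero_object_def Hom_eq_zero_iff by blast
qed

lemma direct_sum_Hom_zero_right:
  assumes "direct_sum C X Y P" "Hom C A X = {0}" "Hom C A Y = {0}"
  shows "Hom C A P = {0}"
proof -
  obtain i j p q where ds: "i \<in> Hom C X P" "j \<in> Hom C Y P" "p \<in> Hom C P X" "q \<in> Hom C P Y"
      "i \<cdot> p + j \<cdot> q = idm C P"
    using assms(1) unfolding direct_sum_def by blast
  have "f = 0" if f: "f \<in> Hom C A P" for f
  proof -
    have pf: "p \<cdot> f = 0" using assms(2) comp_in_Hom[OF f ds(3)] by blast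
    have qf: "q \<cdot> f = 0" using assms(3) comp_in_Hom[OF f ds(4)] by blast
    have "f = (i \<cdot> p + j \<cdot> q) \<cdot> f" using idm_comp[OF f] ds(5) by simp
    also have "\<dots> = i \<cdot> (p \<cdot> f) + j \<cdot> (q \<cdot> f)"
      using comp_add_left[OF f comp_in_Hom[OF ds(3,1)] comp_in_Hom[OF ds(4,2)]]
        comp_assoc[OF f ds(3,1)] comp_assoc[OF f ds(4,2)] by simp
    also have "\<dots> = 0" using pf qf comp_zero_right[OF ds(1)] comp_zero_right[OF ds(2)] by simp
    finally show ?thesis .
  qed
  then show ?thesis unfolding Hom_eq_zero_iff by blast
qed

section \<open>Local endomorphism rings and the Krull-Schmidt property\<close>

lemma local_End_add:
  "local_End C X \<Longrightarrow> f \<in> Hom C X X \<Longrightarrow> g \<in> Hom C X X \<Longrightarrow> iso C X X (f + g) \<Longrightarrow>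
    iso C X X f \<or> iso C X X g"
  unfolding local_End_def by blast

text \<open>The identity is the sum of \<open>i \<cdot> p\<close> and \<open>j \<cdot> q\<close>, so
  by locality one of them is invertible. The projection onto the other summand kills it and
  therefore vanishes.\<close>

lemma local_End_imp_indecomposable:
  assumes "local_End C X"
  shows "indecomposable C X"
proof -
  have "zero_object C Y \<or> zero_object C Z" if YZ: "direct_sum C Y Z X" for Y Z
  proof -
    obtain i j p q where ds: "i \<in> Hom C Y X" "j \<in> Hom C Z X" "p \<in> Hom C X Y" "q \<in> Hom C X Z"
        "p \<cdot> i = idm C Y" "q \<cdot> j = idm C Z" "p \<cdot> j = 0" "q \<cdot> i = 0" "i \<cdot> p + j \<cdot> q = idm C X"
      using YZ unfolding direct_sum_def by blast
    have "iso C X X (i \<cdot> p) \<or> iso C X X (j \<cdot> q)"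
      using local_End_add[OF assms comp_in_Hom[OF ds(3,1)] comp_in_Hom[OF ds(4,2)]] iso_idm[of X] ds(9)
      by simp
    then show ?thesis
    proof
      assume "iso C X X (i \<cdot> p)"
      then obtain h where h: "h \<in> Hom C X X" "(i \<cdot> p) \<cdot> h = idm C X" by (rule isoE)
      have "q = (q \<cdot> i) \<cdot> (p \<cdot> h)"
        using comp_assoc[OF comp_in_Hom[OF h(1) ds(3)] ds(1,4)] comp_assoc[OF h(1) ds(3,1)]
          comp_idm[OF ds(4)] h(2) by simp
      then have "q = 0" using ds(8) comp_zero_left[OF comp_in_Hom[OF h(1) ds(3)]] by simp
      then show ?thesis using ds(6) comp_zero_left[OF ds(2)] zero_object_iff by simp
    next
      assume "iso C X X (j \<cdot> q)"
      then obtain h where h: "h \<in> Hom C X X" "(j \<cdot> q) \<cdot> h = idm C X" by (rule isoE)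
      have "p = (p \<cdot> j) \<cdot> (q \<cdot> h)"
        using comp_assoc[OF comp_in_Hom[OF h(1) ds(4)] ds(2,3)] comp_assoc[OF h(1) ds(4,2)]
          comp_idm[OF ds(3)] h(2) by simp
      then have "p = 0" using ds(7) comp_zero_left[OF comp_in_Hom[OF h(1) ds(4)]] by simp
      then show ?thesis using ds(5) comp_zero_left[OF ds(1)] zero_object_iff by simp
    qed
  qed
  moreover have "\<not> zero_object C X" using assms zero_object_iff unfolding local_End_def by blast
  ultimately show ?thesis unfolding indecomposable_def by blast
qed

lemma subcategory_isomorphic: "subcategory C \<C> \<Longrightarrow> isomorphic C X Y \<Longrightarrow> X \<in> \<C> \<Longrightarrow> Y \<in> \<C>"
  unfolding subcategory_def by blast

lemma subcategory_zero: "subcategory C \<C> \<Longrightarrow> zero_object C Z \<Longrightarrow> Z \<in> \<C>"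
  unfolding subcategory_def by blast

lemma subcategory_direct_sum:
  "subcategory C \<C> \<Longrightarrow> direct_sum C X Y P \<Longrightarrow> X \<in> \<C> \<Longrightarrow> Y \<in> \<C> \<Longrightarrow> P \<in> \<C>"
  unfolding subcategory_def by blast

text \<open>Were all local summands of a decomposition in \<D>, closure under zero objects and
  direct sums would put \<open>A\<close> there too. The induction peels off one summand at a
  time.\<close>

lemma krull_schmidt_summand:
  assumes "krull_schmidt C" "subcategory C \<D>" "A \<notin> \<D>"
  obtains W where "local_End C W" "retract W A" "W \<notin> \<D>"
proof -
  have *: "\<exists>W. local_End C W \<and> retract W A \<and> W \<notin> \<D>"
    if "direct_sum_list C Xs A" "\<forall>Y\<in>set Xs. local_End C Y" "A \<notin> \<D>" for Xs A
    using that
  proof (induction Xs arbitrary: A)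
    case Nil
    then show ?case using subcategory_zero[OF assms(2)] by simp
  next
    case (Cons X Xs)
    then obtain Q where Q: "direct_sum_list C Xs Q" "direct_sum C X Q A" by auto
    show ?case
    proof (cases "X \<in> \<D>")
      case True
      then have "Q \<notin> \<D>" using Cons.prems(3) subcategory_direct_sum[OF assms(2) Q(2)] by blast
      then obtain W where "local_End C W" "retract W Q" "W \<notin> \<D>" using Cons.IH Q(1) Cons.prems(2) by auto
      then show ?thesis using retract_trans direct_sum_imp_retract(2)[OF Q(2)] by blast
    next
      case False
      then show ?thesis using direct_sum_imp_retract(1)[OF Q(2)] Cons.prems(2) by auto
    qed
  qed
  from assms(1) obtain Xs where "direct_sum_list C Xs A" "\<forall>Y\<in>set Xs. local_End C Y"
    unfolding krull_schmidt_def by blast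
  then show ?thesis using * assms(3) that by blast
qed

section \<open>Equivalences\<close>

lemma linear_functorD:
  assumes "linear_functor C F"
  shows linear_functor_Hom: "f \<in> Hom C X Y \<Longrightarrow> mor F f \<in> Hom C (ob F X) (ob F Y)"
    and linear_functor_idm: "mor F (idm C X) = idm C (ob F X)"
    and linear_functor_comp: "f \<in> Hom C X Y \<Longrightarrow> g \<in> Hom C Y Z \<Longrightarrow> mor F (g \<cdot> f) = mor F g \<cdot> mor F f"
    and linear_functor_scal: "f \<in> Hom C X Y \<Longrightarrow> mor F (scal C c f) = scal C c (mor F f)"
    and linear_functor_add: "f \<in> Hom C X Y \<Longrightarrow> f' \<in> Hom C X Y \<Longrightarrow> mor F (f + f') = mor F f + mor F f'"
  using assms unfolding linear_functor_def by blast+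

lemma linear_functor_zero:
  assumes "linear_functor C F"
  shows "mor F 0 = 0"
  using linear_functor_add[OF assms zero_in_Hom zero_in_Hom] by simp

lemma linear_functor_iso:
  assumes "linear_functor C F" "iso C X Y f"
  shows "iso C (ob F X) (ob F Y) (mor F f)"
proof -
  obtain g where g: "f \<in> Hom C X Y" "g \<in> Hom C Y X" "g \<cdot> f = idm C X" "f \<cdot> g = idm C Y"
    using assms(2) by (rule isoE)
  show ?thesis
    by (rule isoI[of _ _ _ "mor F g"])
      (simp_all add: linear_functor_Hom[OF assms(1)] g linear_functor_idm[OF assms(1)]
        linear_functor_comp[OF assms(1) g(1,2), symmetric]
        linear_functor_comp[OF assms(1) g(2,1), symmetric])
qed

lemma linear_functor_isomorphic:
  "linear_functor C F \<Longrightarrow> isomorphic C X Y \<Longrightarrow> isomorphic C (ob F X) (ob F Y)"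
  unfolding isomorphic_def using linear_functor_iso by blast

lemma linear_functor_retract:
  "linear_functor C F \<Longrightarrow> retract X Y \<Longrightarrow> retract (ob F X) (ob F Y)"
  unfolding retract_def
  using linear_functor_Hom[of F] linear_functor_comp[of F, symmetric] linear_functor_idm[of F] by metis

lemma linear_functor_functor_comp:
  assumes "linear_functor C F" "linear_functor C G"
  shows "linear_functor C (F \<odot> G)"
proof -
  note F = linear_functorD[OF assms(1)] and G = linear_functorD[OF assms(2)]
  show ?thesis
    unfolding linear_functor_def functor_comp_def endofunctor.simps
  proof (intro conjI allI ballI)
    fix X Y Z f g assume f: "f \<in> Hom C X Y" and g: "g \<in> Hom C Y Z"
    show "mor F (mor G (g \<cdot> f)) = mor F (mor G g) \<cdot> mor F (mor G f)"
      unfolding G(3)[OF f g] F(3)[OF G(1)[OF f] G(1)[OF g]] ..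
  next
    fix X Y f g assume f: "f \<in> Hom C X Y" and g: "g \<in> Hom C X Y"
    show "mor F (mor G (f + g)) = mor F (mor G f) + mor F (mor G g)"
      unfolding G(5)[OF f g] F(5)[OF G(1)[OF f] G(1)[OF g]] ..
  next
    fix X Y c f assume f: "f \<in> Hom C X Y"
    show "mor F (mor G (scal C c f)) = scal C c (mor F (mor G f))"
      unfolding G(4)[OF f] F(4)[OF G(1)[OF f]] ..
  qed (simp_all add: F(1,2) G(1,2))
qed

lemma quasi_inverse_sym: "quasi_inverse C F G \<Longrightarrow> quasi_inverse C G F"
  unfolding quasi_inverse_def by blast

lemma quasi_inverse_functor:
  "quasi_inverse C F G \<Longrightarrow> linear_functor C F" "quasi_inverse C F G \<Longrightarrow> linear_functor C G"
  unfolding quasi_inverse_def by blast+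

lemma quasi_inverse_unit:
  assumes "quasi_inverse C F G"
  shows "\<exists>\<alpha>. (\<forall>X. iso C (ob G (ob F X)) X (\<alpha> X)) \<and>
    (\<forall>X Y f. f \<in> Hom C X Y \<longrightarrow> \<alpha> Y \<cdot> mor G (mor F f) = f \<cdot> \<alpha> X)"
proof -
  have "naturally_isomorphic C (G \<odot> F) id_functor"
    using assms unfolding quasi_inverse_def by blast
  then show ?thesis
    unfolding naturally_isomorphic_def functor_comp_def id_functor_def endofunctor.simps
    by (simp add: Ball_def)
qed

lemma quasi_inverse_isomorphic:
  assumes "quasi_inverse C F G"
  shows "isomorphic C (ob G (ob F X)) X"
  using quasi_inverse_unit[OF assms] unfolding isomorphic_def by (elim exE conjE) (rule exI, erule spec)

lemma quasi_inverse_faithful: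
  assumes "quasi_inverse C F G" "f \<in> Hom C X Y" "g \<in> Hom C X Y" "mor F f = mor F g"
  shows "f = g"
proof -
  obtain \<alpha> where \<alpha>_unit: "\<forall>X. iso C (ob G (ob F X)) X (\<alpha> X)"
    "\<forall>X Y f. f \<in> Hom C X Y \<longrightarrow> \<alpha> Y \<cdot> mor G (mor F f) = f \<cdot> \<alpha> X"
    using quasi_inverse_unit[OF assms(1)] by (elim exE conjE)
  note \<alpha> = \<alpha>_unit[rule_format]
  obtain \<beta> where \<beta>: "\<alpha> X \<in> Hom C (ob G (ob F X)) X" "\<beta> \<in> Hom C X (ob G (ob F X))" "\<alpha> X \<cdot> \<beta> = idm C X"
    using \<alpha>(1)[of X] by (rule isoE)
  have "f \<cdot> \<alpha> X = g \<cdot> \<alpha> X" using \<alpha>(2)[OF assms(2)] \<alpha>(2)[OF assms(3)] assms(4) by simp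
  then show ?thesis by (rule split_epi_cancel[OF \<beta>(1,2,3) assms(2,3)])
qed

lemma quasi_inverse_full:
  assumes "quasi_inverse C F G" "h \<in> Hom C (ob F X) (ob F Y)"
  obtains f where "f \<in> Hom C X Y" "mor F f = h"
proof -
  obtain \<alpha> where \<alpha>_unit: "\<forall>X. iso C (ob G (ob F X)) X (\<alpha> X)"
    "\<forall>X Y f. f \<in> Hom C X Y \<longrightarrow> \<alpha> Y \<cdot> mor G (mor F f) = f \<cdot> \<alpha> X"
    using quasi_inverse_unit[OF assms(1)] by (elim exE conjE)
  note \<alpha> = \<alpha>_unit[rule_format]
  note F = quasi_inverse_functor(1)[OF assms(1)] and G = quasi_inverse_functor(2)[OF assms(1)]
  obtain \<beta> where \<beta>: "\<alpha> X \<in> Hom C (ob G (ob F X)) X" "\<beta> \<in> Hom C X (ob G (ob F X))"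
      "\<beta> \<cdot> \<alpha> X = idm C (ob G (ob F X))"
    using \<alpha>(1)[of X] by (rule isoE)
  obtain \<gamma> where \<gamma>: "\<alpha> Y \<in> Hom C (ob G (ob F Y)) Y" "\<gamma> \<in> Hom C Y (ob G (ob F Y))"
      "\<gamma> \<cdot> \<alpha> Y = idm C (ob G (ob F Y))"
    using \<alpha>(1)[of Y] by (rule isoE)
  note Gh = linear_functor_Hom[OF G assms(2)]
  \<comment> \<open>Conjugate \<open>mor G h\<close> by the unit. Naturality then gives
    \<open>mor G (mor F f) = mor G h\<close>, and faithfulness of \<open>G\<close> removes the outer
    functor.\<close>
  define f where "f = \<alpha> Y \<cdot> (mor G h \<cdot> \<beta>)"
  have f: "f \<in> Hom C X Y"
    unfolding f_def by (rule comp_in_Hom[OF comp_in_Hom[OF \<beta>(2) Gh] \<gamma>(1)])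
  note GFf = linear_functor_Hom[OF G linear_functor_Hom[OF F f]]
  have "\<alpha> Y \<cdot> mor G (mor F f) = f \<cdot> \<alpha> X" by (rule \<alpha>(2)[OF f])
  also have "\<dots> = \<alpha> Y \<cdot> mor G h"
    unfolding f_def
    using comp_assoc[OF \<beta>(1) comp_in_Hom[OF \<beta>(2) Gh] \<gamma>(1)] comp_assoc[OF \<beta>(1,2) Gh] \<beta>(3)
      comp_idm[OF Gh] by simp
  finally have "\<alpha> Y \<cdot> mor G (mor F f) = \<alpha> Y \<cdot> mor G h" .
  then have "mor G (mor F f) = mor G h" by (rule split_mono_cancel[OF \<gamma>(1,2,3) GFf Gh])
  then have "mor F f = h"
    by (rule quasi_inverse_faithful[OF quasi_inverse_sym[OF assms(1)] linear_functor_Hom[OF F f] assms(2)])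
  with f show ?thesis by (rule that)
qed

lemma quasi_inverse_Hom_zero:
  assumes "quasi_inverse C F G"
  shows "Hom C (ob F X) (ob F Y) = {0} \<longleftrightarrow> Hom C X Y = {0}"
proof -
  note F = quasi_inverse_functor(1)[OF assms]
  have "f = 0" if "Hom C (ob F X) (ob F Y) = {0}" "f \<in> Hom C X Y" for f
    using that linear_functor_Hom[OF F that(2)]
      quasi_inverse_faithful[OF assms that(2) zero_in_Hom] linear_functor_zero[OF F] by auto
  moreover have "h = 0" if "Hom C X Y = {0}" "h \<in> Hom C (ob F X) (ob F Y)" for h
    using quasi_inverse_full[OF assms that(2)] that(1) linear_functor_zero[OF F]
    by (metis singletonD)
  ultimately show ?thesis unfolding Hom_eq_zero_iff by blast
qed

text \<open>Adjointness at the level of vanishing: \<open>Y\<close> is isomorphic to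
  \<open>F (G Y)\<close>, and \<open>F\<close> is fully faithful. This moves shifts from one
  argument of Hom to the other.\<close>

lemma quasi_inverse_adjoint_zero:
  assumes "quasi_inverse C F G"
  shows "Hom C (ob F X) Y = {0} \<longleftrightarrow> Hom C X (ob G Y) = {0}"
  using quasi_inverse_Hom_zero[OF assms, of X "ob G Y"]
    isomorphic_Hom_zero[OF isomorphic_refl[of "ob F X"]
      quasi_inverse_isomorphic[OF quasi_inverse_sym[OF assms], of Y]]
  by simp

lemma quasi_inverse_comp_naturally:
  assumes "quasi_inverse C F G" "quasi_inverse C F' G'"
  shows "naturally_isomorphic C ((G' \<odot> G) \<odot> (F \<odot> F')) id_functor"
proof -
  obtain \<alpha> where \<alpha>_unit: "\<forall>X. iso C (ob G (ob F X)) X (\<alpha> X)"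
    "\<forall>X Y f. f \<in> Hom C X Y \<longrightarrow> \<alpha> Y \<cdot> mor G (mor F f) = f \<cdot> \<alpha> X"
    using quasi_inverse_unit[OF assms(1)] by (elim exE conjE)
  note \<alpha> = \<alpha>_unit[rule_format]
  obtain \<beta> where \<beta>_unit: "\<forall>X. iso C (ob G' (ob F' X)) X (\<beta> X)"
    "\<forall>X Y f. f \<in> Hom C X Y \<longrightarrow> \<beta> Y \<cdot> mor G' (mor F' f) = f \<cdot> \<beta> X"
    using quasi_inverse_unit[OF assms(2)] by (elim exE conjE)
  note \<beta> = \<beta>_unit[rule_format]
  note F = quasi_inverse_functor(1)[OF assms(1)] and G = quasi_inverse_functor(2)[OF assms(1)]
  note F' = quasi_inverse_functor(1)[OF assms(2)] and G' = quasi_inverse_functor(2)[OF assms(2)]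
  define \<gamma> where "\<gamma> X = \<beta> X \<cdot> mor G' (\<alpha> (ob F' X))" for X
  have "iso C (ob G' (ob G (ob F (ob F' X)))) X (\<gamma> X)" for X
    unfolding \<gamma>_def by (rule iso_comp[OF linear_functor_iso[OF G' \<alpha>(1)] \<beta>(1)])
  moreover have "\<gamma> Y \<cdot> mor G' (mor G (mor F (mor F' f))) = f \<cdot> \<gamma> X" if f: "f \<in> Hom C X Y" for X Y f
  proof -
    have \<alpha>H: "\<alpha> A \<in> Hom C (ob G (ob F A)) A" and \<beta>H: "\<beta> A \<in> Hom C (ob G' (ob F' A)) A" for A
      using \<alpha>(1)[of A] \<beta>(1)[of A] unfolding iso_def by blast+
    note F'f = linear_functor_Hom[OF F' f]
    note GFf = linear_functor_Hom[OF G linear_functor_Hom[OF F F'f]]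
    have "\<gamma> Y \<cdot> mor G' (mor G (mor F (mor F' f)))
        = \<beta> Y \<cdot> mor G' (\<alpha> (ob F' Y) \<cdot> mor G (mor F (mor F' f)))"
      unfolding \<gamma>_def linear_functor_comp[OF G' GFf \<alpha>H]
      by (rule comp_assoc[OF linear_functor_Hom[OF G' GFf] linear_functor_Hom[OF G' \<alpha>H] \<beta>H])
    also have "\<dots> = \<beta> Y \<cdot> (mor G' (mor F' f) \<cdot> mor G' (\<alpha> (ob F' X)))"
      unfolding \<alpha>(2)[OF F'f] linear_functor_comp[OF G' \<alpha>H F'f] ..
    also have "\<dots> = (f \<cdot> \<beta> X) \<cdot> mor G' (\<alpha> (ob F' X))"
      using comp_assoc[OF linear_functor_Hom[OF G' \<alpha>H] linear_functor_Hom[OF G' F'f] \<beta>H]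
      unfolding \<beta>(2)[OF f] by simp
    also have "\<dots> = f \<cdot> \<gamma> X"
      unfolding \<gamma>_def by (rule comp_assoc[OF linear_functor_Hom[OF G' \<alpha>H] \<beta>H f])
    finally show ?thesis .
  qed
  ultimately show ?thesis
    unfolding naturally_isomorphic_def functor_comp_def id_functor_def endofunctor.simps
    by (intro exI[of _ \<gamma>] conjI allI ballI)
qed

lemma quasi_inverse_comp:
  assumes "quasi_inverse C F G" "quasi_inverse C F' G'"
  shows "quasi_inverse C (F \<odot> F') (G' \<odot> G)"
  unfolding quasi_inverse_def
  using quasi_inverse_comp_naturally[OF assms]
    quasi_inverse_comp_naturally[OF assms(2,1)[THEN quasi_inverse_sym]]
    assms[THEN quasi_inverse_functor(1)] assms[THEN quasi_inverse_functor(2)]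
    linear_functor_functor_comp by blast

end

section \<open>Triangulated categories\<close>

context triangulated_category
begin

abbreviation sh where "sh \<equiv> ob (shift T)"
abbreviation shm where "shm \<equiv> mor (shift T)"

lemma shift_functor: "linear_functor T (shift T)" and unshift_functor: "linear_functor T (unshift T)"
  using shift_unshift quasi_inverse_functor by blast+

lemmas shm_in_Hom = linear_functor_Hom[OF shift_functor]
  and shm_idm = linear_functor_idm[OF shift_functor]
  and shm_comp = linear_functor_comp[OF shift_functor]
  and shm_zero = linear_functor_zero[OF shift_functor]
  and shm_faithful = quasi_inverse_faithful[OF shift_unshift]
  and shm_full = quasi_inverse_full[OF shift_unshift]

lemma sh_unshift: "isomorphic T (sh (ob (unshift T) X)) X"
  by (rule quasi_inverse_isomorphic[OF quasi_inverse_sym[OF shift_unshift]])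

lemma sh_zero_object: "zero_object T Z \<Longrightarrow> zero_object T (sh Z)"
  using shm_idm[of Z] shm_zero unfolding zero_object_iff by simp

section \<open>Long exact sequences of Hom-spaces\<close>

lemma triD:
  assumes "tri T X Y Z u v w"
  shows "u \<in> Hom T X Y" "v \<in> Hom T Y Z" "w \<in> Hom T Z (sh X)"
  using tri_in_Hom[OF assms] by blast+

lemma rotate:
  assumes "tri T X Y Z u v w"
  shows "tri T Y Z (sh X) v w (- shm u)"
  using tri_rotate[OF triD[OF assms]] assms by blast

lemma tri_comp_zero:
  assumes "tri T X Y Z u v w"
  shows "v \<cdot> u = 0"
proof -
  obtain O' where O': "zero_object T O'" using ex_zero_object by blast
  note uv = triD(1,2)[OF assms]
  obtain c where "c \<in> Hom T O' Z" "c \<cdot> 0 = v \<cdot> u"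
    using tri_morphism[OF tri_idm[OF O'] assms idm_in_Hom uv(1) refl] by blast
  then show ?thesis using comp_zero_right by simp
qed

lemma tri_comp_zero2: "tri T X Y Z u v w \<Longrightarrow> w \<cdot> v = 0"
  by (rule tri_comp_zero[OF rotate])

lemma tri_comp_zero3:
  assumes "tri T X Y Z u v w"
  shows "shm u \<cdot> w = 0"
  using tri_comp_zero2[OF rotate[OF assms]] triD[OF assms]
    comp_uminus_left[OF triD(3)[OF assms] shm_in_Hom[OF triD(1)[OF assms]]] by simp

lemma tri_lift:
  assumes "tri T X Y Z u v w" "f \<in> Hom T A Y" "v \<cdot> f = 0"
  obtains g where "g \<in> Hom T A X" "f = u \<cdot> g"
proof -
  obtain O' where O': "zero_object T O'" using ex_zero_object by blast
  note H = triD[OF assms(1)]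
  have eq: "0 \<cdot> 0 = v \<cdot> f" using assms(3) comp_zero_right[OF zero_in_Hom] by simp
  \<comment> \<open>The morphism axiom fills in only the third map, so both triangles are rotated
    once: the lift appears shifted, and fullness of the shift brings it back.\<close>
  obtain c where c: "c \<in> Hom T (sh A) (sh X)" "shm f \<cdot> (- shm (idm T A)) = (- shm u) \<cdot> c"
    using tri_morphism[OF rotate[OF tri_idm[OF O']] rotate[OF assms(1)] assms(2) zero_in_Hom eq] by blast
  obtain g where g: "g \<in> Hom T A X" "shm g = c" using c(1) by (rule shm_full)
  have "- shm f = - (shm u \<cdot> c)"
    using c(2) comp_uminus_right[OF idm_in_Hom shm_in_Hom[OF assms(2)]] comp_idm[OF shm_in_Hom[OF assms(2)]]
      comp_uminus_left[OF c(1) shm_in_Hom[OF H(1)]] by (simp add: shm_idm)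
  then have "shm f = shm (u \<cdot> g)" using shm_comp[OF g(1) H(1)] g(2) by simp
  then have "f = u \<cdot> g" by (rule shm_faithful[OF assms(2) comp_in_Hom[OF g(1) H(1)]])
  with g(1) show ?thesis by (rule that)
qed

lemma tri_lift2:
  assumes "tri T X Y Z u v w" "f \<in> Hom T A Z" "w \<cdot> f = 0"
  obtains g where "g \<in> Hom T A Y" "f = v \<cdot> g"
  using tri_lift[OF rotate[OF assms(1)] assms(2,3)] by blast

lemma tri_lift3:
  assumes "tri T X Y Z u v w" "f \<in> Hom T A (sh X)" "shm u \<cdot> f = 0"
  obtains g where "g \<in> Hom T A Z" "f = w \<cdot> g"
proof -
  have "(- shm u) \<cdot> f = 0"
    using comp_uminus_left[OF assms(2) shm_in_Hom[OF triD(1)[OF assms(1)]]] assms(3) by simp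
  then show ?thesis using tri_lift2[OF rotate[OF assms(1)] assms(2)] that by blast
qed

lemma tri_extend:
  assumes "tri T X Y Z u v w" "f \<in> Hom T Y A" "f \<cdot> u = 0"
  obtains g where "g \<in> Hom T Z A" "f = g \<cdot> v"
proof -
  obtain O' where O': "zero_object T O'" using ex_zero_object by blast
  have tO: "tri T O' A A 0 (idm T A) 0"
    using tri_rotate[OF zero_in_Hom idm_in_Hom zero_in_Hom, of O' A] tri_idm[OF sh_zero_object[OF O']]
    by (simp add: shm_zero)
  have "f \<cdot> u = 0 \<cdot> 0" using assms(3) comp_zero_right[OF zero_in_Hom] by simp
  then obtain c where "c \<in> Hom T Z A" "c \<cdot> v = idm T A \<cdot> f"
    using tri_morphism[OF assms(1) tO zero_in_Hom assms(2)] by blast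
  then show ?thesis using that[of c] idm_comp[OF assms(2)] by simp
qed

lemma tri_extend2:
  assumes "tri T X Y Z u v w" "f \<in> Hom T Z A" "f \<cdot> v = 0"
  obtains g where "g \<in> Hom T (sh X) A" "f = g \<cdot> w"
  using tri_extend[OF rotate[OF assms(1)] assms(2,3)] by blast

text \<open>The obstruction to extending \<open>f\<close> along \<open>u\<close> is
  \<open>shm f \<cdot> w\<close> in (Z, A[1]). The orthogonality conditions are used mostly to kill
  this obstruction.\<close>

lemma tri_extend3:
  assumes "tri T X Y Z u v w" "f \<in> Hom T X A" "shm f \<cdot> w = 0"
  obtains g where "g \<in> Hom T Y A" "f = g \<cdot> u"
proof -
  note u = triD(1)[OF assms(1)]
  obtain h where h: "h \<in> Hom T (sh Y) (sh A)" "shm f = h \<cdot> (- shm u)"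
    using tri_extend2[OF rotate[OF assms(1)] shm_in_Hom[OF assms(2)] assms(3)] by blast
  obtain g where g: "g \<in> Hom T Y A" "shm g = - h" using uminus_in_Hom[OF h(1)] by (rule shm_full)
  have "shm f = (- h) \<cdot> shm u"
    unfolding h(2) comp_uminus_left[OF shm_in_Hom[OF u] h(1)]
    by (rule comp_uminus_right[OF shm_in_Hom[OF u] h(1)])
  then have "shm f = shm (g \<cdot> u)" unfolding shm_comp[OF u g(1)] g(2) .
  then have "f = g \<cdot> u" by (rule shm_faithful[OF assms(2) comp_in_Hom[OF u g(1)]])
  with g(1) show ?thesis by (rule that)
qed

section \<open>Cocones, complements and split triangles\<close>

lemma ex_tri_cocone:
  assumes "f \<in> Hom T Y Z"
  obtains X u w where "tri T X Y Z u f w"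
proof -
  obtain W a b where t: "tri T Y Z W f a b" using ex_tri[OF assms] by blast
  note H = triD[OF t]
  define X where "X = ob (unshift T) W"
  obtain \<beta> where "iso T W (sh X) \<beta>"
    using isomorphic_sym[OF sh_unshift[of W]] unfolding X_def isomorphic_def by blast
  then obtain \<gamma> where \<beta>: "iso T W (sh X) \<beta>" "\<beta> \<in> Hom T W (sh X)" "\<gamma> \<in> Hom T (sh X) W" "\<gamma> \<cdot> \<beta> = idm T W"
    by (meson isoE)
  note b\<gamma> = comp_in_Hom[OF \<beta>(3) H(3)]
  \<comment> \<open>The cone of \<open>f\<close> has been replaced by the isomorphic
    \<open>sh X\<close>. The sign cancels the one that rotation introduces.\<close>
  obtain u where u: "u \<in> Hom T X Y" "shm u = - (b \<cdot> \<gamma>)"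
    using uminus_in_Hom[OF b\<gamma>] by (rule shm_full)
  note \<beta>a = comp_in_Hom[OF H(2) \<beta>(2)]
  have eqs: "idm T Z \<cdot> f = f \<cdot> idm T Y" "\<beta> \<cdot> a = (\<beta> \<cdot> a) \<cdot> idm T Z" "shm (idm T Y) \<cdot> b = (b \<cdot> \<gamma>) \<cdot> \<beta>"
    using comp_idm[OF assms] idm_comp[OF assms] comp_idm[OF \<beta>a] comp_assoc[OF \<beta>(2,3) H(3)] \<beta>(4)
      comp_idm[OF H(3)] idm_comp[OF H(3)] shm_idm by simp_all
  have "tri T Y Z (sh X) f (\<beta> \<cdot> a) (b \<cdot> \<gamma>)"
    by (rule tri_iso[OF t iso_idm iso_idm \<beta>(1) assms \<beta>a b\<gamma> eqs])
  then have "tri T X Y Z u f (\<beta> \<cdot> a)"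
    using tri_rotate[OF u(1) assms \<beta>a] u(2) by simp
  then show ?thesis by (rule that)
qed

lemma tri_iso_right:
  assumes "tri T X Y Z u v w" "isomorphic T Z Z'"
  obtains v' w' where "tri T X Y Z' u v' w'"
proof -
  note H = triD[OF assms(1)]
  obtain \<beta> where "iso T Z Z' \<beta>" using assms(2) unfolding isomorphic_def by blast
  then obtain \<gamma> where \<beta>: "iso T Z Z' \<beta>" "\<beta> \<in> Hom T Z Z'" "\<gamma> \<in> Hom T Z' Z" "\<gamma> \<cdot> \<beta> = idm T Z"
    by (meson isoE)
  note \<beta>v = comp_in_Hom[OF H(2) \<beta>(2)] and w\<gamma> = comp_in_Hom[OF \<beta>(3) H(3)]
  have eqs: "idm T Y \<cdot> u = u \<cdot> idm T X" "\<beta> \<cdot> v = (\<beta> \<cdot> v) \<cdot> idm T Y" "shm (idm T X) \<cdot> w = (w \<cdot> \<gamma>) \<cdot> \<beta>"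
    using comp_idm[OF H(1)] idm_comp[OF H(1)] comp_idm[OF \<beta>v] comp_assoc[OF \<beta>(2,3) H(3)] \<beta>(4)
      comp_idm[OF H(3)] idm_comp[OF H(3)] shm_idm by simp_all
  show ?thesis
    by (rule that[OF tri_iso[OF assms(1) iso_idm iso_idm \<beta>(1) H(1) \<beta>v w\<gamma> eqs]])
qed

lemma unrotate:
  assumes "tri T Y Z (sh X) v w u'"
  obtains u where "tri T X Y Z u v w"
proof -
  note H = triD[OF assms]
  obtain u where u: "u \<in> Hom T X Y" "shm u = - u'"
    using uminus_in_Hom[OF H(3)] by (rule shm_full)
  have "tri T X Y Z u v w" using tri_rotate[OF u(1) H(1,2)] u(2) assms by simp
  then show ?thesis by (rule that)
qed

text \<open>The complement is the cone of the split monomorphism \<open>i\<close>: the connecting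
  map vanishes, so the map \<open>v\<close> onto the cone has a section.\<close>

lemma retract_complement:
  assumes ip: "i \<in> Hom T W X" "p \<in> Hom T X W" "p \<cdot> i = idm T W"
  obtains Q j q where "j \<in> Hom T Q X" "q \<in> Hom T X Q" "q \<cdot> j = idm T Q" "p \<cdot> j = 0" "q \<cdot> i = 0"
    "i \<cdot> p + j \<cdot> q = idm T X"
proof -
  obtain Q v w where t: "tri T W X Q i v w" using ex_tri[OF ip(1)] by blast
  note H = triD[OF t]
  have "w = shm (p \<cdot> i) \<cdot> w" using ip(3) shm_idm idm_comp[OF H(3)] by simp
  also have "\<dots> = 0"
    unfolding shm_comp[OF ip(1,2)] comp_assoc[OF H(3) shm_in_Hom[OF ip(1)] shm_in_Hom[OF ip(2)]]
      tri_comp_zero3[OF t] by (rule comp_zero_right[OF shm_in_Hom[OF ip(2)]])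
  finally have w: "w = 0" .
  have "w \<cdot> idm T Q = 0" unfolding w by (rule comp_zero_left[OF idm_in_Hom])
  then obtain s where s: "s \<in> Hom T Q X" "idm T Q = v \<cdot> s"
    using tri_lift2[OF t idm_in_Hom] by blast
  \<comment> \<open>The section \<open>s\<close> is corrected by its component in \<open>W\<close>,
    so that \<open>p \<cdot> j = 0\<close>.\<close>
  define j where "j = s - i \<cdot> (p \<cdot> s)"
  note ps = comp_in_Hom[OF s(1) ip(2)]
  note ips = comp_in_Hom[OF ps ip(1)]
  have j: "j \<in> Hom T Q X" unfolding j_def by (rule diff_in_Hom[OF s(1) ips])
  have vj: "v \<cdot> j = idm T Q"
    unfolding j_def comp_diff_right[OF s(1) ips H(2)]
    using comp_assoc[OF ps ip(1) H(2)] tri_comp_zero[OF t] comp_zero_left[OF ps] s(2) by simp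
  have pj: "p \<cdot> j = 0"
    unfolding j_def comp_diff_right[OF s(1) ips ip(2)]
    using comp_assoc[OF ps ip(1,2)] ip(3) idm_comp[OF ps] by simp
  note vi = tri_comp_zero[OF t]
  note ip' = comp_in_Hom[OF ip(2,1)] and jv = comp_in_Hom[OF H(2) j]
  note sum = add_in_Hom[OF ip' jv]
  \<comment> \<open>The defect of the decomposition is killed by \<open>v\<close>, so it factors
    through \<open>i\<close>; it is also killed by \<open>p\<close>, so it is zero.\<close>
  define e where "e = idm T X - (i \<cdot> p + j \<cdot> v)"
  have e: "e \<in> Hom T X X" unfolding e_def by (rule diff_in_Hom[OF idm_in_Hom sum])
  have "v \<cdot> e = 0"
    unfolding e_def comp_diff_right[OF idm_in_Hom sum H(2)] comp_add_right[OF ip' jv H(2)]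
      comp_assoc[OF ip(2,1) H(2), symmetric] comp_assoc[OF H(2) j H(2), symmetric] vi vj
      comp_zero_left[OF ip(2)] idm_comp[OF H(2)] comp_idm[OF H(2)] by simp
  then obtain x where x: "x \<in> Hom T X W" "e = i \<cdot> x" using tri_lift[OF t e] by blast
  have "p \<cdot> e = 0"
    unfolding e_def comp_diff_right[OF idm_in_Hom sum ip(2)] comp_add_right[OF ip' jv ip(2)]
      comp_assoc[OF ip(2,1,2), symmetric] comp_assoc[OF H(2) j ip(2), symmetric] ip(3) pj
      comp_zero_left[OF H(2)] idm_comp[OF ip(2)] comp_idm[OF ip(2)] by simp
  moreover have "p \<cdot> e = x"
    unfolding x(2) comp_assoc[OF x(1) ip(1,2), symmetric] ip(3) by (rule idm_comp[OF x(1)])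
  ultimately have "e = 0" using x(2) comp_zero_right[OF ip(1)] by simp
  then have "i \<cdot> p + j \<cdot> v = idm T X" unfolding e_def by simp
  then show ?thesis by (rule that[OF j H(2) vj pj vi])
qed

lemma subcategory_retract:
  assumes "subcategory T \<C>" "retract W X" "X \<in> \<C>"
  shows "W \<in> \<C>"
proof -
  obtain i p where ip: "i \<in> Hom T W X" "p \<in> Hom T X W" "p \<cdot> i = idm T W"
    using assms(2) by (rule retractE)
  obtain Q j q where "j \<in> Hom T Q X" "q \<in> Hom T X Q" "q \<cdot> j = idm T Q" "p \<cdot> j = 0" "q \<cdot> i = 0"
    "i \<cdot> p + j \<cdot> q = idm T X"
    using ip by (rule retract_complement)
  then have "direct_sum T W Q X" unfolding direct_sum_def using ip by blast
  then show ?thesis using assms(1,3) unfolding subcategory_def by blast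
qed

text \<open>The connecting map lies in a zero Hom-space. This is how Ext-vanishing turns an outer
  term into a summand of the middle one.\<close>

lemma tri_split:
  assumes "tri T X Y Z u v w" "Hom T Z (sh X) = {0}"
  shows "retract Z Y" "retract X Y"
proof -
  note H = triD[OF assms(1)]
  have w: "w = 0" using assms(2) H(3) by blast
  have "w \<cdot> idm T Z = 0" unfolding w by (rule comp_zero_left[OF idm_in_Hom])
  then obtain s where "s \<in> Hom T Z Y" "idm T Z = v \<cdot> s"
    using tri_lift2[OF assms(1) idm_in_Hom] by blast
  then show "retract Z Y" unfolding retract_def using H(2) by metis
  have "shm (idm T X) \<cdot> w = 0" unfolding w by (rule comp_zero_right[OF shm_in_Hom[OF idm_in_Hom]])
  then obtain r where "r \<in> Hom T Y X" "idm T X = r \<cdot> u"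
    using tri_extend3[OF assms(1) idm_in_Hom] by blast
  then show "retract X Y" unfolding retract_def using H(1) by metis
qed

lemma tri_zero_idm:
  assumes "zero_object T Z"
  shows "tri T Z A A 0 (idm T A) 0"
  using tri_rotate[OF zero_in_Hom idm_in_Hom zero_in_Hom, of Z A] tri_idm[OF sh_zero_object[OF assms]]
  by (simp add: shm_zero)

section \<open>Extension-orthogonality\<close>

text \<open>Vanishing of Ext^1(A, B). The perpendiculars of \<X>[-1] and \<X>[1] become
  \<open>ext_right\<close> and \<open>ext_left\<close>, so a single relation serves both.\<close>

definition ext_zero where "ext_zero A B \<longleftrightarrow> Hom T A (sh B) = {0}"
definition ext_right where "ext_right \<X> = {B. \<forall>A\<in>\<X>. ext_zero A B}"
definition ext_left where "ext_left \<X> = {A. \<forall>B\<in>\<X>. ext_zero A B}"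

lemma ext_zeroI: "(\<And>f. f \<in> Hom T A (sh B) \<Longrightarrow> f = 0) \<Longrightarrow> ext_zero A B"
  unfolding ext_zero_def Hom_eq_zero_iff by blast

lemma ext_zeroD: "ext_zero A B \<Longrightarrow> f \<in> Hom T A (sh B) \<Longrightarrow> f = 0"
  unfolding ext_zero_def by blast

lemma ext_zero_retract: "ext_zero A B \<Longrightarrow> retract A' A \<Longrightarrow> retract B' B \<Longrightarrow> ext_zero A' B'"
  unfolding ext_zero_def using retract_zero linear_functor_retract[OF shift_functor] by blast

lemma ext_zero_isomorphic:
  "isomorphic T A A' \<Longrightarrow> isomorphic T B B' \<Longrightarrow> ext_zero A B \<longleftrightarrow> ext_zero A' B'"
  unfolding ext_zero_def
  by (rule isomorphic_Hom_zero[OF _ linear_functor_isomorphic[OF shift_functor]])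

text \<open>In the exact sequence (X, D) -> (X, B) -> (X, A[1]) -> (X, D[1]) the first map is onto
  and the last term is zero. For a right approximation \<open>v\<close> this is Wakamatsu's
  lemma.\<close>

lemma cocone_ext_zero:
  assumes "tri T A D B u v w" "ext_zero X D" "\<And>g. g \<in> Hom T X B \<Longrightarrow> \<exists>h\<in>Hom T X D. g = v \<cdot> h"
  shows "ext_zero X A"
proof (rule ext_zeroI)
  note H = triD[OF assms(1)]
  fix f assume f: "f \<in> Hom T X (sh A)"
  have "shm u \<cdot> f = 0" by (rule ext_zeroD[OF assms(2) comp_in_Hom[OF f shm_in_Hom[OF H(1)]]])
  then obtain g where g: "g \<in> Hom T X B" "f = w \<cdot> g" using tri_lift3[OF assms(1) f] by blast
  obtain h where h: "h \<in> Hom T X D" "g = v \<cdot> h" using assms(3)[OF g(1)] by blast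
  show "f = 0"
    unfolding g(2) h(2) comp_assoc[OF h(1) H(2,3), symmetric] tri_comp_zero2[OF assms(1)]
    by (rule comp_zero_left[OF h(1)])
qed

text \<open>The dual of \<open>cocone_ext_zero\<close>, for cones of left approximations.\<close>

lemma cone_ext_zero:
  assumes "tri T A D B u v w" "ext_zero D X" "\<And>g. g \<in> Hom T A X \<Longrightarrow> \<exists>h\<in>Hom T D X. g = h \<cdot> u"
  shows "ext_zero B X"
proof (rule ext_zeroI)
  note H = triD[OF assms(1)]
  fix f assume f: "f \<in> Hom T B (sh X)"
  have "f \<cdot> v = 0" by (rule ext_zeroD[OF assms(2) comp_in_Hom[OF H(2) f]])
  then obtain g where g: "g \<in> Hom T (sh A) (sh X)" "f = g \<cdot> w" using tri_extend2[OF assms(1) f] by blast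
  obtain g' where g': "g' \<in> Hom T A X" "shm g' = g" using g(1) by (rule shm_full)
  obtain h where h: "h \<in> Hom T D X" "g' = h \<cdot> u" using assms(3)[OF g'(1)] by blast
  show "f = 0"
    unfolding g(2) g'(2)[symmetric] h(2) shm_comp[OF H(1) h(1)]
      comp_assoc[OF H(3) shm_in_Hom[OF H(1)] shm_in_Hom[OF h(1)]] tri_comp_zero3[OF assms(1)]
    by (rule comp_zero_right[OF shm_in_Hom[OF h(1)]])
qed

lemma right_perp_eq: "right_perp T (functor_image T (unshift T) \<X>) = ext_right \<X>"
proof -
  have "Hom T (ob (unshift T) X) B = {0} \<longleftrightarrow> ext_zero X B" for X B
    unfolding ext_zero_def by (rule quasi_inverse_adjoint_zero[OF quasi_inverse_sym[OF shift_unshift]])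
  moreover have "B \<in> right_perp T (functor_image T (unshift T) \<X>) \<longleftrightarrow>
      (\<forall>X\<in>\<X>. Hom T (ob (unshift T) X) B = {0})" for B
    unfolding right_perp_def hom_orthogonal_def functor_image_def
    using isomorphic_Hom_zero[OF _ isomorphic_refl] isomorphic_refl by simp blast
  ultimately show ?thesis unfolding ext_right_def by auto
qed

lemma left_perp_eq: "left_perp T (functor_image T (shift T) \<X>) = ext_left \<X>"
proof -
  have "A \<in> left_perp T (functor_image T (shift T) \<X>) \<longleftrightarrow> (\<forall>X\<in>\<X>. Hom T A (sh X) = {0})" for A
    unfolding left_perp_def hom_orthogonal_def functor_image_def
    using isomorphic_Hom_zero[OF isomorphic_refl] isomorphic_refl by simp blast
  then show ?thesis unfolding ext_left_def ext_zero_def by auto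
qed

lemma two_cluster_tilting_iff:
  "two_cluster_tilting T \<C> \<longleftrightarrow> subcategory T \<C> \<and> functorially_finite T \<C> \<and>
    \<C> = ext_right \<C> \<and> \<C> = ext_left \<C>"
  unfolding two_cluster_tilting_def right_perp_eq left_perp_eq ..

lemma two_rigid_iff: "two_rigid T \<C> \<longleftrightarrow> (\<forall>A\<in>\<C>. \<forall>B\<in>\<C>. ext_zero A B)"
proof -
  have "two_rigid T \<C> \<longleftrightarrow> \<C> \<subseteq> left_perp T (functor_image T (shift T) \<C>)"
    unfolding two_rigid_def left_perp_def hom_orthogonal_def by blast
  then show ?thesis unfolding left_perp_eq ext_left_def by blast
qed

lemma direct_sum_sh: "direct_sum T X Y P \<Longrightarrow> direct_sum T (sh X) (sh Y) (sh P)"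
proof -
  assume "direct_sum T X Y P"
  then obtain i j p q where ds: "i \<in> Hom T X P" "j \<in> Hom T Y P" "p \<in> Hom T P X" "q \<in> Hom T P Y"
      "p \<cdot> i = idm T X" "q \<cdot> j = idm T Y" "p \<cdot> j = 0" "q \<cdot> i = 0" "i \<cdot> p + j \<cdot> q = idm T P"
    unfolding direct_sum_def by blast
  have "shm i \<cdot> shm p + shm j \<cdot> shm q = idm T (sh P)"
    unfolding shm_comp[OF ds(3,1), symmetric] shm_comp[OF ds(4,2), symmetric]
      linear_functor_add[OF shift_functor comp_in_Hom[OF ds(3,1)] comp_in_Hom[OF ds(4,2)], symmetric]
      ds(9) by (rule shm_idm)
  moreover have "shm p \<cdot> shm i = idm T (sh X)" "shm q \<cdot> shm j = idm T (sh Y)"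
      "shm p \<cdot> shm j = 0" "shm q \<cdot> shm i = 0"
    unfolding shm_comp[OF ds(1,3), symmetric] shm_comp[OF ds(2,4), symmetric]
      shm_comp[OF ds(2,3), symmetric] shm_comp[OF ds(1,4), symmetric] ds(5-8) shm_idm shm_zero
    by (rule refl)+
  ultimately show ?thesis
    unfolding direct_sum_def using shm_in_Hom[OF ds(1)] shm_in_Hom[OF ds(2)] shm_in_Hom[OF ds(3)]
      shm_in_Hom[OF ds(4)] by blast
qed

lemma ext_zero_zero_object:
  assumes "zero_object T Z"
  shows "ext_zero Z A" "ext_zero A Z"
  using assms sh_zero_object[OF assms] unfolding ext_zero_def zero_object_def by blast+

lemma ext_right_iff: "B \<in> ext_right \<X> \<longleftrightarrow> (\<forall>A\<in>\<X>. ext_zero A B)"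
  unfolding ext_right_def by blast

lemma ext_right_retract: "B \<in> ext_right \<X> \<Longrightarrow> retract B' B \<Longrightarrow> B' \<in> ext_right \<X>"
  unfolding ext_right_iff
  using ext_zero_retract[OF _ isomorphic_imp_retract[OF isomorphic_refl]] by blast

text \<open>Fixed points of \<open>ext_right\<close> are thus subcategories; this gives
  \<open>shift_up\<close> its closure under sums and summands.\<close>

lemma subcategory_ext_right: "subcategory T (ext_right \<X>)"
  unfolding subcategory_def
proof (intro conjI allI impI; (elim conjE)?)
  fix X Y assume "X \<in> ext_right \<X>" "isomorphic T X Y"
  then show "Y \<in> ext_right \<X>"
    by (rule ext_right_retract[OF _ isomorphic_imp_retract[OF isomorphic_sym]])
next
  fix Z assume "zero_object T Z"
  then show "Z \<in> ext_right \<X>" unfolding ext_right_iff using ext_zero_zero_object(2) by blast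
next
  fix X Y P assume P: "direct_sum T X Y P" and XY: "X \<in> ext_right \<X>" "Y \<in> ext_right \<X>"
  show "P \<in> ext_right \<X>"
    using direct_sum_Hom_zero_right[OF direct_sum_sh[OF P]] XY unfolding ext_right_iff ext_zero_def by simp
next
  fix X Y P assume "direct_sum T X Y P" "P \<in> ext_right \<X>"
  then show "X \<in> ext_right \<X>" "Y \<in> ext_right \<X>"
    by (auto intro: ext_right_retract direct_sum_imp_retract)
qed

text \<open>The map \<open>(m, d)\<close> out of a direct sum, with the property by which a summand
  from \<D> is later added to an approximation.\<close>

lemma ex_morphism_from_sum:
  assumes "m \<in> Hom T X A" "d \<in> Hom T Y A" "direct_sum T X Y P"
  obtains g where "g \<in> Hom T P A"
    "\<And>W a r. a \<in> Hom T W X \<Longrightarrow> r \<in> Hom T W Y \<Longrightarrow> \<exists>h\<in>Hom T W P. g \<cdot> h = m \<cdot> a + d \<cdot> r"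
proof -
  obtain i j p q where ds: "i \<in> Hom T X P" "j \<in> Hom T Y P" "p \<in> Hom T P X" "q \<in> Hom T P Y"
      "p \<cdot> i = idm T X" "q \<cdot> j = idm T Y" "p \<cdot> j = 0" "q \<cdot> i = 0"
    using assms(3) unfolding direct_sum_def by blast
  note mp = comp_in_Hom[OF ds(3) assms(1)] and dq = comp_in_Hom[OF ds(4) assms(2)]
  define g where "g = m \<cdot> p + d \<cdot> q"
  have g: "g \<in> Hom T P A" unfolding g_def by (rule add_in_Hom[OF mp dq])
  have gi: "g \<cdot> i = m"
    unfolding g_def comp_add_left[OF ds(1) mp dq] comp_assoc[OF ds(1,3) assms(1)]
      comp_assoc[OF ds(1,4) assms(2)] ds(5,8) comp_idm[OF assms(1)] comp_zero_right[OF assms(2)] by simp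
  have gj: "g \<cdot> j = d"
    unfolding g_def comp_add_left[OF ds(2) mp dq] comp_assoc[OF ds(2,3) assms(1)]
      comp_assoc[OF ds(2,4) assms(2)] ds(6,7) comp_idm[OF assms(2)] comp_zero_right[OF assms(1)] by simp
  have "\<exists>h\<in>Hom T W P. g \<cdot> h = m \<cdot> a + d \<cdot> r" if a: "a \<in> Hom T W X" and r: "r \<in> Hom T W Y" for W a r
  proof
    note ia = comp_in_Hom[OF a ds(1)] and jr = comp_in_Hom[OF r ds(2)]
    show "i \<cdot> a + j \<cdot> r \<in> Hom T W P" by (rule add_in_Hom[OF ia jr])
    show "g \<cdot> (i \<cdot> a + j \<cdot> r) = m \<cdot> a + d \<cdot> r"
      unfolding comp_add_right[OF ia jr g] comp_assoc[OF a ds(1) g, symmetric]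
        comp_assoc[OF r ds(2) g, symmetric] gi gj ..
  qed
  with g show ?thesis by (rule that)
qed

lemma ex_morphism_to_sum:
  assumes "m \<in> Hom T A X" "d \<in> Hom T A Y" "direct_sum T X Y P"
  obtains g where "g \<in> Hom T A P"
    "\<And>W a r. a \<in> Hom T X W \<Longrightarrow> r \<in> Hom T Y W \<Longrightarrow> \<exists>h\<in>Hom T P W. h \<cdot> g = a \<cdot> m + r \<cdot> d"
proof -
  obtain i j p q where ds: "i \<in> Hom T X P" "j \<in> Hom T Y P" "p \<in> Hom T P X" "q \<in> Hom T P Y"
      "p \<cdot> i = idm T X" "q \<cdot> j = idm T Y" "p \<cdot> j = 0" "q \<cdot> i = 0"
    using assms(3) unfolding direct_sum_def by blast
  note im = comp_in_Hom[OF assms(1) ds(1)] and jd = comp_in_Hom[OF assms(2) ds(2)]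
  define g where "g = i \<cdot> m + j \<cdot> d"
  have g: "g \<in> Hom T A P" unfolding g_def by (rule add_in_Hom[OF im jd])
  have pg: "p \<cdot> g = m"
    unfolding g_def comp_add_right[OF im jd ds(3)] comp_assoc[OF assms(1) ds(1,3), symmetric]
      comp_assoc[OF assms(2) ds(2,3), symmetric] ds(5,7) idm_comp[OF assms(1)] comp_zero_left[OF assms(2)]
    by simp
  have qg: "q \<cdot> g = d"
    unfolding g_def comp_add_right[OF im jd ds(4)] comp_assoc[OF assms(1) ds(1,4), symmetric]
      comp_assoc[OF assms(2) ds(2,4), symmetric] ds(6,8) idm_comp[OF assms(2)] comp_zero_left[OF assms(1)]
    by simp
  have "\<exists>h\<in>Hom T P W. h \<cdot> g = a \<cdot> m + r \<cdot> d" if a: "a \<in> Hom T X W" and r: "r \<in> Hom T Y W" for W a r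
  proof
    note ap = comp_in_Hom[OF ds(3) a] and rq = comp_in_Hom[OF ds(4) r]
    show "a \<cdot> p + r \<cdot> q \<in> Hom T P W" by (rule add_in_Hom[OF ap rq])
    show "(a \<cdot> p + r \<cdot> q) \<cdot> g = a \<cdot> m + r \<cdot> d"
      unfolding comp_add_left[OF g ap rq] comp_assoc[OF g ds(3) a] comp_assoc[OF g ds(4) r] pg qg ..
  qed
  with g show ?thesis by (rule that)
qed

end

section \<open>Mutation\<close>

text \<open>Serre duality enters through \<open>ext_right_D\<close>, which makes \<Z> self-dual;
  \<open>S2_subcategory_ext_right\<close> supplies it.\<close>

locale mutation_base = triangulated_category T
  for T :: "('k::field, 'o, 'm::ab_group_add, 'z) tri_cat_scheme" (structure) +
  fixes \<D> :: "'o set"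
  assumes subcategory_D: "subcategory T \<D>"
    and functorially_finite_D: "functorially_finite T \<D>"
    and rigid_D: "\<And>A B. A \<in> \<D> \<Longrightarrow> B \<in> \<D> \<Longrightarrow> ext_zero A B"
    and ext_right_D: "ext_right \<D> = ext_left \<D>"
begin

definition \<Z> where "\<Z> = ext_right \<D>"

text \<open>In the subfactor category \<open>\<Z>/[\<D>]\<close>, the object \<open>B\<close> is the shift of \<open>A\<close>.\<close>

definition cosyzygy where
  "cosyzygy A B \<longleftrightarrow> A \<in> \<Z> \<and> B \<in> \<Z> \<and> (\<exists>D\<in>\<D>. \<exists>u v w. tri T A D B u v w)"

lemma cosyzygyE:
  assumes "cosyzygy A B"
  obtains D u v w where "A \<in> \<Z>" "B \<in> \<Z>" "D \<in> \<D>" "tri T A D B u v w"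
  using assms unfolding cosyzygy_def by blast

lemma Z_right: "A \<in> \<Z> \<Longrightarrow> D \<in> \<D> \<Longrightarrow> f \<in> Hom T D (sh A) \<Longrightarrow> f = 0"
  unfolding \<Z>_def ext_right_def using ext_zeroD by blast

lemma Z_left: "A \<in> \<Z> \<Longrightarrow> D \<in> \<D> \<Longrightarrow> f \<in> Hom T A (sh D) \<Longrightarrow> f = 0"
  unfolding \<Z>_def ext_right_D ext_left_def using ext_zeroD by blast

lemma D_subset_Z: "\<D> \<subseteq> \<Z>"
  unfolding \<Z>_def ext_right_def using rigid_D by blast

lemma zero_in_Z: "zero_object T Z \<Longrightarrow> Z \<in> \<Z>"
  using subcategory_zero[OF subcategory_D] D_subset_Z by blast

text \<open>As \<open>B\<close> lies in \<Z>, the obstruction in (B, D'[1]) vanishes. So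
  \<open>u\<close> is automatically a left \<D>-approximation, and dually \<open>v\<close> is a
  right one.\<close>

lemma left_approximation_of_tri:
  assumes "tri T A D B u v w" "B \<in> \<Z>" "D' \<in> \<D>" "f \<in> Hom T A D'"
  obtains g where "g \<in> Hom T D D'" "f = g \<cdot> u"
proof -
  have "shm f \<cdot> w = 0"
    by (rule Z_left[OF assms(2,3) comp_in_Hom[OF triD(3)[OF assms(1)] shm_in_Hom[OF assms(4)]]])
  then show ?thesis using tri_extend3[OF assms(1,4)] that by blast
qed

lemma right_approximation_of_tri:
  assumes "tri T A D B u v w" "A \<in> \<Z>" "D' \<in> \<D>" "f \<in> Hom T D' B"
  obtains g where "g \<in> Hom T D' D" "f = v \<cdot> g"
proof -
  have "w \<cdot> f = 0"
    by (rule Z_right[OF assms(2,3) comp_in_Hom[OF assms(4) triD(3)[OF assms(1)]]])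
  then show ?thesis using tri_lift2[OF assms(1,4)] that by blast
qed

section \<open>The shift on the subfactor category\<close>

lemma ex_right_approximation: "\<exists>X f. right_approximation T \<D> A X f"
  and ex_left_approximation: "\<exists>X f. left_approximation T \<D> A X f"
  using functorially_finite_D unfolding functorially_finite_def by blast+

text \<open>The cocone of a right \<D>-approximation of \<open>B\<close> lies in \<Z> by Wakamatsu's
  lemma.\<close>

lemma ex_cosyzygy_left:
  assumes "B \<in> \<Z>"
  obtains A where "cosyzygy A B"
proof -
  obtain D v where v: "D \<in> \<D>" "v \<in> Hom T D B"
      "\<And>D' g. D' \<in> \<D> \<Longrightarrow> g \<in> Hom T D' B \<Longrightarrow> \<exists>h\<in>Hom T D' D. g = v \<cdot> h"
    using ex_right_approximation[of B] unfolding right_approximation_def by blast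
  obtain A u w where t: "tri T A D B u v w" using ex_tri_cocone[OF v(2)] by blast
  have "A \<in> \<Z>"
    unfolding \<Z>_def ext_right_def using cocone_ext_zero[OF t rigid_D[OF _ v(1)] v(3)] by blast
  then show ?thesis using that assms v(1) t unfolding cosyzygy_def by blast
qed

lemma ex_cosyzygy_right:
  assumes "A \<in> \<Z>"
  obtains B where "cosyzygy A B"
proof -
  obtain D u where u: "D \<in> \<D>" "u \<in> Hom T A D"
      "\<And>D' g. D' \<in> \<D> \<Longrightarrow> g \<in> Hom T A D' \<Longrightarrow> \<exists>h\<in>Hom T D D'. g = h \<cdot> u"
    using ex_left_approximation[of A] unfolding left_approximation_def by blast
  obtain B v w where t: "tri T A D B u v w" using ex_tri[OF u(2)] by blast
  have "B \<in> \<Z>"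
    unfolding \<Z>_def ext_right_D ext_left_def using cone_ext_zero[OF t rigid_D[OF u(1)] u(3)] by blast
  then show ?thesis using that assms u(1) t unfolding cosyzygy_def by blast
qed

text \<open>Both Ext-spaces are quotients of (A, B'): Ext^1(A, A') by the maps factoring through
  \<open>v'\<close>, Ext^1(B, B') by those factoring through \<open>u\<close>. As \<open>u\<close>
  and \<open>v'\<close> are \<D>-approximations, both are the maps factoring through \<D>.\<close>

lemma cosyzygy_ext_zero:
  assumes "cosyzygy A B" "cosyzygy A' B'"
  shows "ext_zero A A' \<longleftrightarrow> ext_zero B B'"
proof -
  obtain D u v w where t: "A \<in> \<Z>" "B \<in> \<Z>" "D \<in> \<D>" "tri T A D B u v w"
    using assms(1) by (rule cosyzygyE)
  obtain D' u' v' w' where t': "A' \<in> \<Z>" "B' \<in> \<Z>" "D' \<in> \<D>" "tri T A' D' B' u' v' w'"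
    using assms(2) by (rule cosyzygyE)
  note H = triD[OF t(4)] and H' = triD[OF t'(4)]
  show ?thesis
  proof
    assume A: "ext_zero A A'"
    show "ext_zero B B'"
    proof (rule ext_zeroI)
      fix f assume f: "f \<in> Hom T B (sh B')"
      have "f \<cdot> v = 0" by (rule Z_right[OF t'(2) t(3) comp_in_Hom[OF H(2) f]])
      then obtain g1 where g1: "g1 \<in> Hom T (sh A) (sh B')" "f = g1 \<cdot> w"
        using tri_extend2[OF t(4) f] by blast
      obtain g where g: "g \<in> Hom T A B'" "shm g = g1" using g1(1) by (rule shm_full)
      have "w' \<cdot> g = 0" by (rule ext_zeroD[OF A comp_in_Hom[OF g(1) H'(3)]])
      then obtain k where k: "k \<in> Hom T A D'" "g = v' \<cdot> k" using tri_lift2[OF t'(4) g(1)] by blast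
      obtain l where l: "l \<in> Hom T D D'" "k = l \<cdot> u"
        using left_approximation_of_tri[OF t(4,2) t'(3) k(1)] by blast
      note vl = comp_in_Hom[OF l(1) H'(2)]
      have "g = (v' \<cdot> l) \<cdot> u" unfolding k(2) l(2) by (rule comp_assoc[OF H(1) l(1) H'(2), symmetric])
      then have "f = shm (v' \<cdot> l) \<cdot> (shm u \<cdot> w)"
        using g1(2) g(2) shm_comp[OF H(1) vl] comp_assoc[OF H(3) shm_in_Hom[OF H(1)] shm_in_Hom[OF vl]]
        by simp
      then show "f = 0" unfolding tri_comp_zero3[OF t(4)] comp_zero_right[OF shm_in_Hom[OF vl]] .
    qed
  next
    assume B: "ext_zero B B'"
    show "ext_zero A A'"
    proof (rule ext_zeroI)
      fix g assume g: "g \<in> Hom T A (sh A')"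
      have "shm u' \<cdot> g = 0" by (rule Z_left[OF t(1) t'(3) comp_in_Hom[OF g shm_in_Hom[OF H'(1)]]])
      then obtain h where h: "h \<in> Hom T A B'" "g = w' \<cdot> h" using tri_lift3[OF t'(4) g] by blast
      have "shm h \<cdot> w = 0" by (rule ext_zeroD[OF B comp_in_Hom[OF H(3) shm_in_Hom[OF h(1)]]])
      then obtain k where k: "k \<in> Hom T D B'" "h = k \<cdot> u" using tri_extend3[OF t(4) h(1)] by blast
      obtain l where l: "l \<in> Hom T D D'" "k = v' \<cdot> l"
        using right_approximation_of_tri[OF t'(4,1) t(3) k(1)] by blast
      note lu = comp_in_Hom[OF H(1) l(1)]
      have "g = (w' \<cdot> v') \<cdot> (l \<cdot> u)"
        unfolding h(2) k(2) l(2) comp_assoc[OF H(1) l(1) H'(2)] by (rule comp_assoc[OF lu H'(2,3), symmetric])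
      then show "g = 0" unfolding tri_comp_zero2[OF t'(4)] comp_zero_left[OF lu] .
    qed
  qed
qed

text \<open>The objects of the shifts \<open>\<U>\<langle>1\<rangle>\<close> and \<open>\<U>\<langle>-1\<rangle>\<close> of \<open>\<U>\<close> in \<open>\<Z>/[\<D>]\<close>.\<close>

definition shift_up where "shift_up \<U> = {B. \<exists>A\<in>\<U>. cosyzygy A B}"
definition shift_down where "shift_down \<U> = {A. \<exists>B\<in>\<U>. cosyzygy A B}"

text \<open>The triangles 0 -> D -> D and D -> D -> 0 relate every object of \<D> to the zero object
  of \<U>.\<close>

lemma D_subset_shifts:
  assumes "subcategory T \<U>"
  shows "\<D> \<subseteq> shift_up \<U>" "\<D> \<subseteq> shift_down \<U>"
proof -
  obtain O' where O': "zero_object T O'" using ex_zero_object by blast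
  have "O' \<in> \<U>" using subcategory_zero[OF assms O'] .
  moreover have "cosyzygy O' D" "cosyzygy D O'" if "D \<in> \<D>" for D
    using that zero_in_Z[OF O'] D_subset_Z tri_zero_idm[OF O'] tri_idm[OF O'] unfolding cosyzygy_def
    by blast+
  ultimately show "\<D> \<subseteq> shift_up \<U>" "\<D> \<subseteq> shift_down \<U>"
    unfolding shift_up_def shift_down_def by blast+
qed

lemma ext_right_mono: "\<X> \<subseteq> \<Y> \<Longrightarrow> ext_right \<Y> \<subseteq> ext_right \<X>"
  unfolding ext_right_def by blast

lemma ext_left_mono: "\<X> \<subseteq> \<Y> \<Longrightarrow> ext_left \<Y> \<subseteq> ext_left \<X>"
  unfolding ext_left_def by blast

lemma subset_Z: "\<U> = ext_right \<U> \<Longrightarrow> \<D> \<subseteq> \<U> \<Longrightarrow> \<U> \<subseteq> \<Z>"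
  unfolding \<Z>_def using ext_right_mono by blast

text \<open>An object orthogonal to \<open>shift_up \<U>\<close> is orthogonal to \<D>, so it lies
  in \<Z> and is the shift of some \<open>A\<close>. By \<open>cosyzygy_ext_zero\<close>,
  \<open>A\<close> is orthogonal to \<U> and hence belongs to it.\<close>

lemma shift_up_ext_closed:
  assumes "subcategory T \<U>" "\<D> \<subseteq> \<U>" "\<U> = ext_right \<U>" "\<U> = ext_left \<U>"
  shows "shift_up \<U> = ext_right (shift_up \<U>)" "shift_up \<U> = ext_left (shift_up \<U>)"
proof -
  have rigid: "ext_zero B B'" if "B \<in> shift_up \<U>" "B' \<in> shift_up \<U>" for B B'
    using that cosyzygy_ext_zero assms(3) unfolding shift_up_def ext_right_def by blast
  have ex: "\<exists>B\<in>shift_up \<U>. cosyzygy A B" if "A \<in> \<U>" for A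
    using ex_cosyzygy_right[of A] subset_Z[OF assms(3,2)] that unfolding shift_up_def by blast
  have "B \<in> shift_up \<U>" if B: "B \<in> ext_right (shift_up \<U>)" for B
  proof -
    have "B \<in> \<Z>" using B ext_right_mono[OF D_subset_shifts(1)[OF assms(1)]] unfolding \<Z>_def by blast
    then obtain A where A: "cosyzygy A B" by (rule ex_cosyzygy_left)
    have "ext_zero A' A" if A': "A' \<in> \<U>" for A'
    proof -
      obtain B' where "B' \<in> shift_up \<U>" "cosyzygy A' B'" using ex[OF A'] by blast
      then show ?thesis using cosyzygy_ext_zero[OF _ A] B unfolding ext_right_def by blast
    qed
    then have "A \<in> ext_right \<U>" unfolding ext_right_def by blast
    then show ?thesis using A assms(3) unfolding shift_up_def by blast
  qed
  then show "shift_up \<U> = ext_right (shift_up \<U>)" using rigid unfolding ext_right_def by blast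
  have "B \<in> shift_up \<U>" if B: "B \<in> ext_left (shift_up \<U>)" for B
  proof -
    have "B \<in> \<Z>" using B ext_left_mono[OF D_subset_shifts(1)[OF assms(1)]] unfolding \<Z>_def ext_right_D by blast
    then obtain A where A: "cosyzygy A B" by (rule ex_cosyzygy_left)
    have "ext_zero A A'" if A': "A' \<in> \<U>" for A'
    proof -
      obtain B' where "B' \<in> shift_up \<U>" "cosyzygy A' B'" using ex[OF A'] by blast
      then show ?thesis using cosyzygy_ext_zero[OF A] B unfolding ext_left_def by blast
    qed
    then have "A \<in> ext_left \<U>" unfolding ext_left_def by blast
    then show ?thesis using A assms(4) unfolding shift_up_def by blast
  qed
  then show "shift_up \<U> = ext_left (shift_up \<U>)" using rigid unfolding ext_left_def by blast
qed

text \<open>Mirror image of \<open>shift_up_ext_closed\<close>.\<close>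

lemma shift_down_ext_closed:
  assumes "subcategory T \<U>" "\<D> \<subseteq> \<U>" "\<U> = ext_right \<U>" "\<U> = ext_left \<U>"
  shows "shift_down \<U> = ext_right (shift_down \<U>)" "shift_down \<U> = ext_left (shift_down \<U>)"
proof -
  have rigid: "ext_zero B B'" if "B \<in> shift_down \<U>" "B' \<in> shift_down \<U>" for B B'
    using that cosyzygy_ext_zero assms(3) unfolding shift_down_def ext_right_def by blast
  have ex: "\<exists>B\<in>shift_down \<U>. cosyzygy B A" if "A \<in> \<U>" for A
    using ex_cosyzygy_left[of A] subset_Z[OF assms(3,2)] that unfolding shift_down_def by blast
  have "B \<in> shift_down \<U>" if B: "B \<in> ext_right (shift_down \<U>)" for B
  proof -
    have "B \<in> \<Z>" using B ext_right_mono[OF D_subset_shifts(2)[OF assms(1)]] unfolding \<Z>_def by blast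
    then obtain A where A: "cosyzygy B A" by (rule ex_cosyzygy_right)
    have "ext_zero A' A" if A': "A' \<in> \<U>" for A'
    proof -
      obtain B' where "B' \<in> shift_down \<U>" "cosyzygy B' A'" using ex[OF A'] by blast
      then show ?thesis using cosyzygy_ext_zero[OF _ A] B unfolding ext_right_def by blast
    qed
    then have "A \<in> ext_right \<U>" unfolding ext_right_def by blast
    then show ?thesis using A assms(3) unfolding shift_down_def by blast
  qed
  then show "shift_down \<U> = ext_right (shift_down \<U>)" using rigid unfolding ext_right_def by blast
  have "B \<in> shift_down \<U>" if B: "B \<in> ext_left (shift_down \<U>)" for B
  proof -
    have "B \<in> \<Z>" using B ext_left_mono[OF D_subset_shifts(2)[OF assms(1)]] unfolding \<Z>_def ext_right_D by blast
    then obtain A where A: "cosyzygy B A" by (rule ex_cosyzygy_right)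
    have "ext_zero A A'" if A': "A' \<in> \<U>" for A'
    proof -
      obtain B' where "B' \<in> shift_down \<U>" "cosyzygy B' A'" using ex[OF A'] by blast
      then show ?thesis using cosyzygy_ext_zero[OF A] B unfolding ext_left_def by blast
    qed
    then have "A \<in> ext_left \<U>" unfolding ext_left_def by blast
    then show ?thesis using A assms(4) unfolding shift_down_def by blast
  qed
  then show "shift_down \<U> = ext_left (shift_down \<U>)" using rigid unfolding ext_left_def by blast
qed

section \<open>Functorial finiteness of the shifted subcategory\<close>

lemma ex_right_Z_approximation: "\<exists>X f. right_approximation T \<Z> A X f"
proof -
  define U where "U = ob (unshift T) A"
  \<comment> \<open>A left \<D>-approximation of A[-1] becomes, after rotation, a map A -> D[1].
    Maps from \<Z> compose with it to zero, so they lift to the cone \<open>X\<close>.\<close>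
  obtain D l where l: "D \<in> \<D>" "l \<in> Hom T U D"
      "\<And>D' g. D' \<in> \<D> \<Longrightarrow> g \<in> Hom T U D' \<Longrightarrow> \<exists>h\<in>Hom T D D'. g = h \<cdot> l"
    using ex_left_approximation[of U] unfolding left_approximation_def by blast
  obtain X t i where tri: "tri T U D X l t i" using ex_tri[OF l(2)] by blast
  have X: "X \<in> \<Z>"
    unfolding \<Z>_def ext_right_D ext_left_def using cone_ext_zero[OF tri rigid_D[OF l(1)] l(3)] by blast
  have "isomorphic T (sh U) A" unfolding U_def by (rule sh_unshift)
  then obtain v w where tri': "tri T D X A t v w" using tri_iso_right[OF rotate[OF tri]] by blast
  have "\<exists>h\<in>Hom T X' X. g = v \<cdot> h" if "X' \<in> \<Z>" "g \<in> Hom T X' A" for X' g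
  proof -
    have "w \<cdot> g = 0" by (rule Z_left[OF that(1) l(1) comp_in_Hom[OF that(2) triD(3)[OF tri']]])
    then show ?thesis using tri_lift2[OF tri' that(2)] by blast
  qed
  then have "right_approximation T \<Z> A X v"
    unfolding right_approximation_def using X triD(2)[OF tri'] by blast
  then show ?thesis by blast
qed

lemma ex_left_Z_approximation: "\<exists>X f. left_approximation T \<Z> A X f"
proof -
  obtain D r where r: "D \<in> \<D>" "r \<in> Hom T D (sh A)"
      "\<And>D' g. D' \<in> \<D> \<Longrightarrow> g \<in> Hom T D' (sh A) \<Longrightarrow> \<exists>h\<in>Hom T D' D. g = r \<cdot> h"
    using ex_right_approximation[of "sh A"] unfolding right_approximation_def by blast
  obtain X u w where tri: "tri T X D (sh A) u r w" using ex_tri_cocone[OF r(2)] by blast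
  have X: "X \<in> \<Z>"
    unfolding \<Z>_def ext_right_def using cocone_ext_zero[OF tri rigid_D[OF _ r(1)] r(3)] by blast
  obtain v where tri': "tri T A X D v u r" using unrotate[OF tri] by blast
  have "\<exists>h\<in>Hom T X X'. g = h \<cdot> v" if "X' \<in> \<Z>" "g \<in> Hom T A X'" for X' g
  proof -
    have "shm g \<cdot> r = 0" by (rule Z_right[OF that(1) r(1) comp_in_Hom[OF r(2) shm_in_Hom[OF that(2)]]])
    then show ?thesis using tri_extend3[OF tri' that(2)] by blast
  qed
  then have "left_approximation T \<Z> A X v"
    unfolding left_approximation_def using X triD(1)[OF tri'] by blast
  then show ?thesis by blast
qed

text \<open>Shift \<open>A\<close> down to \<open>B\<close>, approximate \<open>B\<close> from \<U>
  by \<open>X\<close>, and shift that approximation up to \<open>m\<close> from \<open>G\<close> to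
  \<open>A\<close>. Maps into \<open>A\<close> factor through \<open>m\<close> up to maps through
  \<D>, which the extra summand \<open>D0\<close> absorbs.\<close>

lemma shift_up_right_approximation:
  assumes \<U>: "subcategory T (shift_up \<U>)" "\<D> \<subseteq> shift_up \<U>" "\<U> \<subseteq> \<Z>"
    and ff: "\<And>B. \<exists>X f. right_approximation T \<U> B X f" and A: "A \<in> \<Z>"
  shows "\<exists>X f. right_approximation T (shift_up \<U>) A X f"
proof -
  obtain B where "cosyzygy B A" using ex_cosyzygy_left[OF A] .
  then obtain D0 b d w where B: "B \<in> \<Z>" "D0 \<in> \<D>" and t: "tri T B D0 A b d w" by (rule cosyzygyE)
  obtain X c where X: "X \<in> \<U>" "c \<in> Hom T X B"
      and c: "\<And>X' g. X' \<in> \<U> \<Longrightarrow> g \<in> Hom T X' B \<Longrightarrow> \<exists>h\<in>Hom T X' X. g = c \<cdot> h"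
    using ff[of B] unfolding right_approximation_def by blast
  obtain G where XG: "cosyzygy X G" using ex_cosyzygy_right[of X] X(1) \<U>(3) by blast
  then obtain D' x y z where G: "G \<in> \<Z>" "D' \<in> \<D>" and s: "tri T X D' G x y z" by (rule cosyzygyE)
  note H = triD[OF t] and K = triD[OF s]
  obtain k where k: "k \<in> Hom T D' D0" "b \<cdot> c = k \<cdot> x"
    using left_approximation_of_tri[OF s G(1) B(2) comp_in_Hom[OF X(2) H(1)]] by blast
  obtain m where m: "m \<in> Hom T G A" "shm c \<cdot> z = w \<cdot> m"
    using tri_morphism[OF s t X(2) k(1) k(2)[symmetric]] by blast
  obtain P where P: "direct_sum T G D0 P" using ex_direct_sum by blast
  obtain g where g: "g \<in> Hom T P A" and gP:
    "\<And>W a r. a \<in> Hom T W G \<Longrightarrow> r \<in> Hom T W D0 \<Longrightarrow> \<exists>h\<in>Hom T W P. g \<cdot> h = m \<cdot> a + d \<cdot> r"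
    using ex_morphism_from_sum[OF m(1) H(2) P] by blast
  have "G \<in> shift_up \<U>" using XG X(1) unfolding shift_up_def by blast
  then have "P \<in> shift_up \<U>" using subcategory_direct_sum[OF \<U>(1) P] B(2) \<U>(2) by blast
  moreover have "\<exists>h\<in>Hom T N P. n = g \<cdot> h" if N: "N \<in> shift_up \<U>" and n: "n \<in> Hom T N A" for N n
  proof -
    obtain X' where X': "X' \<in> \<U>" "cosyzygy X' N" using N unfolding shift_up_def by blast
    obtain D'' x' y' z' where N': "N \<in> \<Z>" "D'' \<in> \<D>" and s': "tri T X' D'' N x' y' z'"
      using X'(2) by (rule cosyzygyE)
    note L = triD[OF s']
    note wn = comp_in_Hom[OF n H(3)]
    \<comment> \<open>As (D'', B[1]) vanishes, \<open>w \<cdot> n\<close> comes from a map X' -> B,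
      to which the approximation \<open>c\<close> applies.\<close>
    have "(w \<cdot> n) \<cdot> y' = 0" by (rule Z_right[OF B(1) N'(2) comp_in_Hom[OF L(2) wn]])
    then obtain \<beta> where \<beta>: "\<beta> \<in> Hom T (sh X') (sh B)" "w \<cdot> n = \<beta> \<cdot> z'"
      using tri_extend2[OF s' wn] by blast
    obtain b' where b': "b' \<in> Hom T X' B" "shm b' = \<beta>" using \<beta>(1) by (rule shm_full)
    obtain e where e: "e \<in> Hom T X' X" "b' = c \<cdot> e" using c[OF X'(1) b'(1)] by blast
    obtain k' where k': "k' \<in> Hom T D'' D'" "x \<cdot> e = k' \<cdot> x'"
      using left_approximation_of_tri[OF s' N'(1) G(2) comp_in_Hom[OF e(1) K(1)]] by blast
    obtain a where a: "a \<in> Hom T N G" "shm e \<cdot> z' = z \<cdot> a"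
      using tri_morphism[OF s' s e(1) k'(1) k'(2)[symmetric]] by blast
    note ma = comp_in_Hom[OF a(1) m(1)]
    \<comment> \<open>The maps \<open>n\<close> and \<open>m \<cdot> a\<close> agree after
      \<open>w\<close>, so their difference comes from \<open>D0\<close>.\<close>
    have "w \<cdot> (m \<cdot> a) = (shm c \<cdot> z) \<cdot> a"
      unfolding m(2) by (rule comp_assoc[OF a(1) m(1) H(3), symmetric])
    also have "\<dots> = shm c \<cdot> (shm e \<cdot> z')"
      unfolding a(2) by (rule comp_assoc[OF a(1) K(3) shm_in_Hom[OF X(2)]])
    also have "\<dots> = w \<cdot> n"
      unfolding \<beta>(2) b'(2)[symmetric] e(2) shm_comp[OF e(1) X(2)]
      by (rule comp_assoc[OF L(3) shm_in_Hom[OF e(1)] shm_in_Hom[OF X(2)], symmetric])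
    finally have "w \<cdot> (n - m \<cdot> a) = 0" unfolding comp_diff_right[OF n ma H(3)] by simp
    then obtain r where r: "r \<in> Hom T N D0" "n - m \<cdot> a = d \<cdot> r"
      using tri_lift2[OF t diff_in_Hom[OF n ma]] by blast
    have "n = m \<cdot> a + d \<cdot> r" unfolding r(2)[symmetric] by simp
    then show ?thesis using gP[OF a(1) r(1)] by metis
  qed
  ultimately have "right_approximation T (shift_up \<U>) A P g"
    unfolding right_approximation_def using g by blast
  then show ?thesis by blast
qed

lemma shift_up_left_approximation:
  assumes \<U>: "subcategory T (shift_up \<U>)" "\<D> \<subseteq> shift_up \<U>" "\<U> \<subseteq> \<Z>"
    and ff: "\<And>B. \<exists>X f. left_approximation T \<U> B X f" and A: "A \<in> \<Z>"
  shows "\<exists>X f. left_approximation T (shift_up \<U>) A X f"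
proof -
  obtain B where "cosyzygy B A" using ex_cosyzygy_left[OF A] .
  then obtain D0 b d w where B: "B \<in> \<Z>" "D0 \<in> \<D>" and t: "tri T B D0 A b d w" by (rule cosyzygyE)
  obtain X c where X: "X \<in> \<U>" "c \<in> Hom T B X"
      and c: "\<And>X' g. X' \<in> \<U> \<Longrightarrow> g \<in> Hom T B X' \<Longrightarrow> \<exists>h\<in>Hom T X X'. g = h \<cdot> c"
    using ff[of B] unfolding left_approximation_def by blast
  obtain G where XG: "cosyzygy X G" using ex_cosyzygy_right[of X] X(1) \<U>(3) by blast
  then obtain D' x y z where G: "G \<in> \<Z>" "D' \<in> \<D>" and s: "tri T X D' G x y z" by (rule cosyzygyE)
  note H = triD[OF t] and K = triD[OF s]
  obtain k where k: "k \<in> Hom T D0 D'" "x \<cdot> c = k \<cdot> b"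
    using left_approximation_of_tri[OF t A G(2) comp_in_Hom[OF X(2) K(1)]] by blast
  obtain m where m: "m \<in> Hom T A G" "shm c \<cdot> w = z \<cdot> m"
    using tri_morphism[OF t s X(2) k(1) k(2)[symmetric]] by blast
  \<comment> \<open>The error terms pass through an object \<open>D''\<close> that depends on
    \<open>N\<close>. The added summand is therefore a left \<D>-approximation of \<open>A\<close>,
    through which all of them factor.\<close>
  obtain E l where E: "E \<in> \<D>" "l \<in> Hom T A E"
      and l: "\<And>D' g. D' \<in> \<D> \<Longrightarrow> g \<in> Hom T A D' \<Longrightarrow> \<exists>h\<in>Hom T E D'. g = h \<cdot> l"
    using ex_left_approximation[of A] unfolding left_approximation_def by blast
  obtain P where P: "direct_sum T G E P" using ex_direct_sum by blast
  obtain g where g: "g \<in> Hom T A P" and gP: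
    "\<And>W a r. a \<in> Hom T G W \<Longrightarrow> r \<in> Hom T E W \<Longrightarrow> \<exists>h\<in>Hom T P W. h \<cdot> g = a \<cdot> m + r \<cdot> l"
    using ex_morphism_to_sum[OF m(1) E(2) P] by blast
  have "G \<in> shift_up \<U>" using XG X(1) unfolding shift_up_def by blast
  then have "P \<in> shift_up \<U>" using subcategory_direct_sum[OF \<U>(1) P] E(1) \<U>(2) by blast
  moreover have "\<exists>h\<in>Hom T P N. n = h \<cdot> g" if N: "N \<in> shift_up \<U>" and n: "n \<in> Hom T A N" for N n
  proof -
    obtain X' where X': "X' \<in> \<U>" "cosyzygy X' N" using N unfolding shift_up_def by blast
    obtain D'' x' y' z' where N': "X' \<in> \<Z>" "D'' \<in> \<D>" and s': "tri T X' D'' N x' y' z'"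
      using X'(2) by (rule cosyzygyE)
    note L = triD[OF s']
    note zn = comp_in_Hom[OF n L(3)]
    have "(z' \<cdot> n) \<cdot> d = 0" by (rule Z_right[OF N'(1) B(2) comp_in_Hom[OF H(2) zn]])
    then obtain \<beta> where \<beta>: "\<beta> \<in> Hom T (sh B) (sh X')" "z' \<cdot> n = \<beta> \<cdot> w"
      using tri_extend2[OF t zn] by blast
    obtain b' where b': "b' \<in> Hom T B X'" "shm b' = \<beta>" using \<beta>(1) by (rule shm_full)
    obtain e where e: "e \<in> Hom T X X'" "b' = e \<cdot> c" using c[OF X'(1) b'(1)] by blast
    obtain k' where k': "k' \<in> Hom T D' D''" "x' \<cdot> e = k' \<cdot> x"
      using left_approximation_of_tri[OF s G(1) N'(2) comp_in_Hom[OF e(1) L(1)]] by blast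
    obtain a where a: "a \<in> Hom T G N" "shm e \<cdot> z = z' \<cdot> a"
      using tri_morphism[OF s s' e(1) k'(1) k'(2)[symmetric]] by blast
    note am = comp_in_Hom[OF m(1) a(1)]
    have "z' \<cdot> (a \<cdot> m) = (shm e \<cdot> z) \<cdot> m"
      unfolding a(2) by (rule comp_assoc[OF m(1) a(1) L(3), symmetric])
    also have "\<dots> = shm e \<cdot> (shm c \<cdot> w)"
      unfolding m(2) by (rule comp_assoc[OF m(1) K(3) shm_in_Hom[OF e(1)]])
    also have "\<dots> = z' \<cdot> n"
      unfolding \<beta>(2) b'(2)[symmetric] e(2) shm_comp[OF X(2) e(1)]
      by (rule comp_assoc[OF H(3) shm_in_Hom[OF X(2)] shm_in_Hom[OF e(1)], symmetric])
    finally have "z' \<cdot> (n - a \<cdot> m) = 0" unfolding comp_diff_right[OF n am L(3)] by simp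
    then obtain r where r: "r \<in> Hom T A D''" "n - a \<cdot> m = y' \<cdot> r"
      using tri_lift2[OF s' diff_in_Hom[OF n am]] by blast
    obtain r' where r': "r' \<in> Hom T E D''" "r = r' \<cdot> l" using l[OF N'(2) r(1)] by blast
    have "n = a \<cdot> m + (y' \<cdot> r') \<cdot> l"
      unfolding comp_assoc[OF E(2) r'(1) L(2)] r'(2)[symmetric] r(2)[symmetric] by simp
    then show ?thesis using gP[OF a(1) comp_in_Hom[OF r'(1) L(2)]] by metis
  qed
  ultimately have "left_approximation T (shift_up \<U>) A P g"
    unfolding left_approximation_def using g by blast
  then show ?thesis by blast
qed

text \<open>Reduces approximations of arbitrary objects to those of objects in \<Z>.\<close>

lemma right_approximation_trans:
  assumes "right_approximation T \<Z> A X f" "right_approximation T \<U> X Y g" "\<U> \<subseteq> \<Z>"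
  shows "right_approximation T \<U> A Y (f \<cdot> g)"
proof -
  have f: "f \<in> Hom T X A" "\<And>W h. W \<in> \<Z> \<Longrightarrow> h \<in> Hom T W A \<Longrightarrow> \<exists>k\<in>Hom T W X. h = f \<cdot> k"
    using assms(1) unfolding right_approximation_def by blast+
  have g: "Y \<in> \<U>" "g \<in> Hom T Y X" "\<And>W h. W \<in> \<U> \<Longrightarrow> h \<in> Hom T W X \<Longrightarrow> \<exists>k\<in>Hom T W Y. h = g \<cdot> k"
    using assms(2) unfolding right_approximation_def by blast+
  have "\<exists>k\<in>Hom T W Y. h = (f \<cdot> g) \<cdot> k" if W: "W \<in> \<U>" "h \<in> Hom T W A" for W h
  proof -
    obtain h' where h': "h' \<in> Hom T W X" "h = f \<cdot> h'" using f(2) W assms(3) by blast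
    obtain k where k: "k \<in> Hom T W Y" "h' = g \<cdot> k" using g(3)[OF W(1) h'(1)] by blast
    have "h = (f \<cdot> g) \<cdot> k" unfolding h'(2) k(2) by (rule comp_assoc[OF k(1) g(2) f(1), symmetric])
    with k(1) show ?thesis by blast
  qed
  then show ?thesis unfolding right_approximation_def using g(1) comp_in_Hom[OF g(2) f(1)] by blast
qed

lemma left_approximation_trans:
  assumes "left_approximation T \<Z> A X f" "left_approximation T \<U> X Y g" "\<U> \<subseteq> \<Z>"
  shows "left_approximation T \<U> A Y (g \<cdot> f)"
proof -
  have f: "f \<in> Hom T A X" "\<And>W h. W \<in> \<Z> \<Longrightarrow> h \<in> Hom T A W \<Longrightarrow> \<exists>k\<in>Hom T X W. h = k \<cdot> f"
    using assms(1) unfolding left_approximation_def by blast+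
  have g: "Y \<in> \<U>" "g \<in> Hom T X Y" "\<And>W h. W \<in> \<U> \<Longrightarrow> h \<in> Hom T X W \<Longrightarrow> \<exists>k\<in>Hom T Y W. h = k \<cdot> g"
    using assms(2) unfolding left_approximation_def by blast+
  have "\<exists>k\<in>Hom T Y W. h = k \<cdot> (g \<cdot> f)" if W: "W \<in> \<U>" "h \<in> Hom T A W" for W h
  proof -
    obtain h' where h': "h' \<in> Hom T X W" "h = h' \<cdot> f" using f(2) W assms(3) by blast
    obtain k where k: "k \<in> Hom T Y W" "h' = k \<cdot> g" using g(3)[OF W(1) h'(1)] by blast
    have "h = k \<cdot> (g \<cdot> f)" unfolding h'(2) k(2) by (rule comp_assoc[OF f(1) g(2) k(1)])
    with k(1) show ?thesis by blast
  qed
  then show ?thesis unfolding left_approximation_def using g(1) comp_in_Hom[OF f(1) g(2)] by blast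
qed

lemma two_cluster_tilting_shift_up:
  assumes "two_cluster_tilting T \<C>" "\<D> \<subseteq> \<C>"
  shows "two_cluster_tilting T (shift_up \<C>)"
proof -
  have C: "subcategory T \<C>" "functorially_finite T \<C>" "\<C> = ext_right \<C>" "\<C> = ext_left \<C>"
    using assms(1) unfolding two_cluster_tilting_iff by blast+
  note closed = shift_up_ext_closed[OF C(1) assms(2) C(3,4)]
  have sub: "subcategory T (shift_up \<C>)" by (subst closed(1)) (rule subcategory_ext_right)
  note D = D_subset_shifts(1)[OF C(1)] and CZ = subset_Z[OF C(3) assms(2)]
  have NZ: "shift_up \<C> \<subseteq> \<Z>" unfolding shift_up_def cosyzygy_def by blast
  have ff: "\<exists>X f. right_approximation T \<C> B X f" "\<exists>X f. left_approximation T \<C> B X f" for B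
    using C(2) unfolding functorially_finite_def by blast+
  have "\<exists>X f. right_approximation T (shift_up \<C>) A X f" for A
  proof -
    obtain X f where X: "right_approximation T \<Z> A X f" using ex_right_Z_approximation by blast
    then have "X \<in> \<Z>" unfolding right_approximation_def by blast
    then obtain Y g where "right_approximation T (shift_up \<C>) X Y g"
      using shift_up_right_approximation[OF sub D CZ ff(1)] by blast
    then show ?thesis using right_approximation_trans[OF X _ NZ] by blast
  qed
  moreover have "\<exists>X f. left_approximation T (shift_up \<C>) A X f" for A
  proof -
    obtain X f where X: "left_approximation T \<Z> A X f" using ex_left_Z_approximation by blast
    then have "X \<in> \<Z>" unfolding left_approximation_def by blast
    then obtain Y g where "left_approximation T (shift_up \<C>) X Y g"
      using shift_up_left_approximation[OF sub D CZ ff(2)] by blast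
    then show ?thesis using left_approximation_trans[OF X _ NZ] by blast
  qed
  ultimately have "functorially_finite T (shift_up \<C>)" unfolding functorially_finite_def by blast
  then show ?thesis unfolding two_cluster_tilting_iff using sub closed by blast
qed

end

section \<open>Minimal approximations\<close>

context triangulated_category
begin

text \<open>Right minimality, phrased in terms of direct summands of \<open>X\<close> instead of endomorphisms.\<close>

definition min_right_approximation where
  "min_right_approximation \<C> A X f \<longleftrightarrow> right_approximation T \<C> A X f \<and>
    (\<forall>W. \<forall>i\<in>Hom T W X. \<forall>p\<in>Hom T X W. p \<cdot> i = idm T W \<and> f \<cdot> i = 0 \<longrightarrow> zero_object T W)"

lemma right_approximationD:
  assumes "right_approximation T \<C> A X f"
  shows "X \<in> \<C>" "f \<in> Hom T X A" "\<And>X' g. X' \<in> \<C> \<Longrightarrow> g \<in> Hom T X' A \<Longrightarrow> \<exists>h\<in>Hom T X' X. g = f \<cdot> h"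
  using assms unfolding right_approximation_def by blast+

lemma min_right_approximationD:
  assumes "min_right_approximation \<C> A X f"
  shows "right_approximation T \<C> A X f"
    and "i \<in> Hom T W X \<Longrightarrow> p \<in> Hom T X W \<Longrightarrow> p \<cdot> i = idm T W \<Longrightarrow> f \<cdot> i = 0 \<Longrightarrow> zero_object T W"
  using assms unfolding min_right_approximation_def by blast+

text \<open>The ambient space may be infinite-dimensional, so finiteness of the bases comes from a
  finite spanning set of the Hom-space. A basis of \<open>U\<close> together with \<open>z\<close>
  stays independent.\<close>

lemma dim_less_of_proper_subspace:
  assumes "hom_finite T" "module.subspace (scal T) U" "U \<subseteq> V" "V \<subseteq> Hom T X Y" "z \<in> V" "z \<notin> U"
  shows "vector_space.dim (scal T) U < vector_space.dim (scal T) V"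
proof -
  interpret vs: vector_space "scal T" by (rule vector_space)
  obtain F where F: "finite F" "vs.span F = Hom T X Y"
    using assms(1) unfolding hom_finite_def by blast
  obtain B where B: "B \<subseteq> U" "vs.independent B" "U \<subseteq> vs.span B" "card B = vs.dim U"
    using vs.basis_exists by blast
  obtain B' where B': "B' \<subseteq> V" "vs.independent B'" "V \<subseteq> vs.span B'" "card B' = vs.dim V"
    using vs.basis_exists by blast
  have fin: "finite B" "finite B'"
    using vs.independent_span_bound[OF F(1) B(2)] vs.independent_span_bound[OF F(1) B'(2)] F(2)
      B(1) B'(1) assms(3,4) by auto
  have z: "z \<notin> vs.span B" using vs.span_minimal[OF B(1) assms(2)] assms(6) by blast
  then have "vs.independent (insert z B)" using B(2) vs.independent_insert[of z B] by simp
  then have "card (insert z B) \<le> card B'"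
    using vs.independent_span_bound[OF fin(2)] B(1) B'(3) assms(3,5) by auto
  moreover have "z \<notin> B" using z vs.span_base by blast
  ultimately show ?thesis using fin(1) B(4) B'(4) by simp
qed

text \<open>For an idempotent \<open>e\<close> these are the endomorphisms with image in the summand
  cut out by \<open>e\<close>.\<close>

lemma subspace_fixed:
  assumes "e \<in> Hom T X X"
  shows "module.subspace (scal T) {x \<in> Hom T X X. e \<cdot> x = x}"
proof -
  interpret vs: vector_space "scal T" by (rule vector_space)
  have "scal T c x \<in> Hom T X X" if "x \<in> Hom T X X" for c x
    using that subspace_Hom vs.subspace_scale by blast
  then show ?thesis
    by (intro vs.subspaceI)
      (auto simp: comp_zero_right[OF assms] add_in_Hom comp_add_right[OF _ _ assms] comp_scal_right[OF _ assms])
qed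

text \<open>
  Among the right approximations \<open>X \<rightarrow> A\<close> with \<open>X\<close> a direct summand of a given one \<open>X\<^sub>0 \<rightarrow> A\<close>,
  take one for which the subspace of \<open>End X\<^sub>0\<close> of all endomorphisms with image in \<open>X\<close> has least dimension.
\<close>

lemma ex_min_right_approximation:
  assumes "hom_finite T" "subcategory T \<C>" "right_approximation T \<C> A X0 f0"
  obtains X f where "min_right_approximation \<C> A X f"
proof -
  \<comment> \<open>The splitting \<open>a\<close>, \<open>b\<close> is carried along because the
    measure \<open>m\<close> refers to the idempotent \<open>a \<cdot> b\<close>.\<close>
  define P where "P = (\<lambda>(X, f, a, b). right_approximation T \<C> A X f \<and>
    a \<in> Hom T X X0 \<and> b \<in> Hom T X0 X \<and> b \<cdot> a = idm T X)"
  define V where "V e = {x \<in> Hom T X0 X0. e \<cdot> x = x}" for e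
  define m where "m = (\<lambda>(X :: 'o, f :: 'm, a, b). vector_space.dim (scal T) (V (a \<cdot> b)))"
  have "P (X0, f0, idm T X0, idm T X0)"
    unfolding P_def using assms(3) idm_in_Hom comp_idm[OF idm_in_Hom] by simp
  then obtain s where s: "P s" "\<And>t. P t \<Longrightarrow> m s \<le> m t"
    using exists_least_iff[of "\<lambda>n. \<exists>s. P s \<and> m s = n"] by (metis not_le)
  obtain X f a b where s_eq: "s = (X, f, a, b)" using prod_cases4 .
  have approx: "right_approximation T \<C> A X f"
    and a: "a \<in> Hom T X X0" and b: "b \<in> Hom T X0 X" and ba: "b \<cdot> a = idm T X"
    using s(1) unfolding s_eq P_def by simp_all
  note f = right_approximationD[OF approx]
  have "zero_object T W"
    if i: "i \<in> Hom T W X" and p: "p \<in> Hom T X W" and pi: "p \<cdot> i = idm T W" and fi: "f \<cdot> i = 0" for W i p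
  proof (rule ccontr)
    assume nz: "\<not> zero_object T W"
    \<comment> \<open>A nonzero summand \<open>W\<close> killed by \<open>f\<close> can be
      discarded: the complement \<open>Q\<close> still carries an approximation, but has a smaller
      measure.\<close>
    obtain Q j q where j: "j \<in> Hom T Q X" and q: "q \<in> Hom T X Q" and qj: "q \<cdot> j = idm T Q"
      and pj: "p \<cdot> j = 0" and qi: "q \<cdot> i = 0" and sum: "i \<cdot> p + j \<cdot> q = idm T X"
      using i p pi by (rule retract_complement)
    have "retract Q X" unfolding retract_def using j q qj by blast
    then have Q: "Q \<in> \<C>" by (rule subcategory_retract[OF assms(2) _ f(1)])
    have "\<exists>h\<in>Hom T X' Q. g = (f \<cdot> j) \<cdot> h" if X': "X' \<in> \<C>" "g \<in> Hom T X' A" for X' g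
    proof -
      obtain k where k: "k \<in> Hom T X' X" "g = f \<cdot> k" using f(3)[OF X'] by blast
      note pk = comp_in_Hom[OF k(1) p] and qk = comp_in_Hom[OF k(1) q]
      have "k = i \<cdot> (p \<cdot> k) + j \<cdot> (q \<cdot> k)"
        using comp_add_left[OF k(1) comp_in_Hom[OF p i] comp_in_Hom[OF q j]] sum idm_comp[OF k(1)]
          comp_assoc[OF k(1) p i] comp_assoc[OF k(1) q j] by simp
      then have "f \<cdot> k = f \<cdot> (i \<cdot> (p \<cdot> k)) + f \<cdot> (j \<cdot> (q \<cdot> k))"
        using comp_add_right[OF comp_in_Hom[OF pk i] comp_in_Hom[OF qk j] f(2)] by simp
      also have "\<dots> = (f \<cdot> j) \<cdot> (q \<cdot> k)"
        unfolding comp_assoc[OF pk i f(2), symmetric] comp_assoc[OF qk j f(2)] fi comp_zero_left[OF pk]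
        by simp
      finally show ?thesis using k(2) qk by blast
    qed
    then have "right_approximation T \<C> A Q (f \<cdot> j)"
      unfolding right_approximation_def using Q comp_in_Hom[OF j f(2)] by blast
    moreover note aj = comp_in_Hom[OF j a] and qb = comp_in_Hom[OF b q]
    moreover have "(q \<cdot> b) \<cdot> (a \<cdot> j) = idm T Q"
      unfolding comp_assoc[OF aj b q] comp_assoc[OF j a b, symmetric] ba idm_comp[OF j] by (rule qj)
    ultimately have "P (Q, f \<cdot> j, a \<cdot> j, q \<cdot> b)" unfolding P_def by simp
    then have le: "vector_space.dim (scal T) (V (a \<cdot> b)) \<le> vector_space.dim (scal T) (V ((a \<cdot> j) \<cdot> (q \<cdot> b)))"
      using s(2)[of "(Q, f \<cdot> j, a \<cdot> j, q \<cdot> b)"] unfolding s_eq m_def by simp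
    note ab = comp_in_Hom[OF b a]
    define e where "e = (a \<cdot> j) \<cdot> (q \<cdot> b)"
    have e: "e \<in> Hom T X0 X0" unfolding e_def by (rule comp_in_Hom[OF qb aj])
    have ab_a: "(a \<cdot> b) \<cdot> (a \<cdot> x) = a \<cdot> x" if "x \<in> Hom T Y X" for x Y
      unfolding comp_assoc[OF comp_in_Hom[OF that a] b a] comp_assoc[OF that a b, symmetric] ba
        idm_comp[OF that] ..
    have e_a: "e = a \<cdot> (j \<cdot> (q \<cdot> b))" unfolding e_def by (rule comp_assoc[OF qb j a])
    have sub: "V e \<subseteq> V (a \<cdot> b)"
    proof
      fix x assume "x \<in> V e"
      then have x: "x \<in> Hom T X0 X0" "e \<cdot> x = x" unfolding V_def by blast+
      have "(a \<cdot> b) \<cdot> (e \<cdot> x) = e \<cdot> x"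
        unfolding comp_assoc[OF x(1) e ab, symmetric] using ab_a[OF comp_in_Hom[OF qb j]] e_a by simp
      then show "x \<in> V (a \<cdot> b)" unfolding V_def using x by simp
    qed
    \<comment> \<open>The idempotent of \<open>X0\<close> onto \<open>W\<close>: it is fixed by
      \<open>a \<cdot> b\<close> but not by \<open>e\<close>, so the inclusion is strict.\<close>
    define z where "z = a \<cdot> (i \<cdot> (p \<cdot> b))"
    note pb = comp_in_Hom[OF b p]
    note ipb = comp_in_Hom[OF pb i]
    have z: "z \<in> Hom T X0 X0" unfolding z_def by (rule comp_in_Hom[OF ipb a])
    have z1: "z \<in> V (a \<cdot> b)" unfolding V_def using z ab_a[OF ipb] z_def by simp
    have z2: "z \<notin> V e"
    proof
      assume "z \<in> V e"
      then have ez: "e \<cdot> z = z" unfolding V_def by blast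
      have "b \<cdot> z = i \<cdot> (p \<cdot> b)"
        unfolding z_def comp_assoc[OF ipb a b, symmetric] ba by (rule idm_comp[OF ipb])
      moreover have "(q \<cdot> b) \<cdot> z = q \<cdot> (b \<cdot> z)" by (rule comp_assoc[OF z b q])
      ultimately have "(q \<cdot> b) \<cdot> z = 0"
        using comp_assoc[OF pb i q] qi comp_zero_left[OF pb] by simp
      then have "z = 0" using ez comp_assoc[OF z qb aj] comp_zero_right[OF aj] unfolding e_def by simp
      then have "i \<cdot> (p \<cdot> b) = 0" using \<open>b \<cdot> z = i \<cdot> (p \<cdot> b)\<close> comp_zero_right[OF b] by simp
      then have "p \<cdot> b = 0"
        using comp_assoc[OF pb i p] pi idm_comp[OF pb] comp_zero_right[OF p] by simp
      then have "p = 0" using comp_assoc[OF a b p] ba comp_idm[OF p] comp_zero_left[OF a] by simp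
      then show False using nz pi comp_zero_left[OF i] unfolding zero_object_iff by simp
    qed
    have "V (a \<cdot> b) \<subseteq> Hom T X0 X0" unfolding V_def by blast
    moreover have "module.subspace (scal T) (V e)" unfolding V_def by (rule subspace_fixed[OF e])
    ultimately have "vector_space.dim (scal T) (V e) < vector_space.dim (scal T) (V (a \<cdot> b))"
      using dim_less_of_proper_subspace[OF assms(1) _ sub _ z1 z2] by blast
    then show False using le unfolding e_def by simp
  qed
  then have "min_right_approximation \<C> A X f"
    unfolding min_right_approximation_def using approx by blast
  then show ?thesis by (rule that)
qed

text \<open>Every test object \<open>Y\<close> is isomorphic to \<open>F (G Y)\<close>, so by full
  faithfulness factorisations and split summands for \<open>mor F f\<close> reduce to those for
  \<open>f\<close>.\<close>

lemma min_right_approximation_equivalence: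
  assumes "quasi_inverse T F G" "subcategory T \<C>"
    and FC: "\<And>X. X \<in> \<C> \<Longrightarrow> ob F X \<in> \<C>" and GC: "\<And>X. X \<in> \<C> \<Longrightarrow> ob G X \<in> \<C>"
    and min: "min_right_approximation \<C> A X f"
  shows "min_right_approximation \<C> (ob F A) (ob F X) (mor F f)"
proof -
  note f = right_approximationD[OF min_right_approximationD(1)[OF min]]
  note F = linear_functorD[OF quasi_inverse_functor(1)[OF assms(1)]]
  have ess: "\<exists>\<beta> \<gamma>. \<beta> \<in> Hom T (ob F (ob G Y)) Y \<and> \<gamma> \<in> Hom T Y (ob F (ob G Y)) \<and> \<beta> \<cdot> \<gamma> = idm T Y \<and>
      \<gamma> \<cdot> \<beta> = idm T (ob F (ob G Y))" for Y
    using quasi_inverse_isomorphic[OF quasi_inverse_sym[OF assms(1)], of Y]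
    unfolding isomorphic_def iso_def by blast
  have "\<exists>h\<in>Hom T Y (ob F X). g = mor F f \<cdot> h" if Y: "Y \<in> \<C>" and g: "g \<in> Hom T Y (ob F A)" for Y g
  proof -
    obtain \<beta> \<gamma> where \<beta>: "\<beta> \<in> Hom T (ob F (ob G Y)) Y" "\<gamma> \<in> Hom T Y (ob F (ob G Y))" "\<beta> \<cdot> \<gamma> = idm T Y"
      using ess by blast
    obtain g' where g': "g' \<in> Hom T (ob G Y) A" "mor F g' = g \<cdot> \<beta>"
      using quasi_inverse_full[OF assms(1) comp_in_Hom[OF \<beta>(1) g]] by blast
    obtain k where k: "k \<in> Hom T (ob G Y) X" "g' = f \<cdot> k" using f(3)[OF GC[OF Y] g'(1)] by blast
    have "g = (g \<cdot> \<beta>) \<cdot> \<gamma>" unfolding comp_assoc[OF \<beta>(2,1) g] \<beta>(3) comp_idm[OF g] ..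
    also have "\<dots> = mor F f \<cdot> (mor F k \<cdot> \<gamma>)"
      unfolding g'(2)[symmetric] k(2) F(3)[OF k(1) f(2)] by (rule comp_assoc[OF \<beta>(2) F(1)[OF k(1)] F(1)[OF f(2)]])
    finally show ?thesis using comp_in_Hom[OF \<beta>(2) F(1)[OF k(1)]] by blast
  qed
  then have "right_approximation T \<C> (ob F A) (ob F X) (mor F f)"
    unfolding right_approximation_def using FC[OF f(1)] F(1)[OF f(2)] by blast
  moreover have "zero_object T W" if i: "i \<in> Hom T W (ob F X)" and p: "p \<in> Hom T (ob F X) W"
      and pi: "p \<cdot> i = idm T W" and fi: "mor F f \<cdot> i = 0" for W i p
  proof -
    obtain \<beta> \<gamma> where \<beta>: "\<beta> \<in> Hom T (ob F (ob G W)) W" "\<gamma> \<in> Hom T W (ob F (ob G W))"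
        "\<beta> \<cdot> \<gamma> = idm T W" "\<gamma> \<cdot> \<beta> = idm T (ob F (ob G W))"
      using ess by blast
    note i\<beta> = comp_in_Hom[OF \<beta>(1) i] and \<gamma>p = comp_in_Hom[OF p \<beta>(2)]
    obtain i' where i': "i' \<in> Hom T (ob G W) X" "mor F i' = i \<cdot> \<beta>"
      using quasi_inverse_full[OF assms(1) i\<beta>] by blast
    obtain p' where p': "p' \<in> Hom T X (ob G W)" "mor F p' = \<gamma> \<cdot> p"
      using quasi_inverse_full[OF assms(1) \<gamma>p] by blast
    have "mor F (p' \<cdot> i') = mor F (idm T (ob G W))"
      unfolding F(2) F(3)[OF i'(1) p'(1)] i'(2) p'(2) comp_assoc[OF i\<beta> p \<beta>(2)]
        comp_assoc[OF \<beta>(1) i p, symmetric] pi idm_comp[OF \<beta>(1)] by (rule \<beta>(4))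
    then have pi': "p' \<cdot> i' = idm T (ob G W)"
      by (rule quasi_inverse_faithful[OF assms(1) comp_in_Hom[OF i'(1) p'(1)] idm_in_Hom])
    have "mor F (f \<cdot> i') = mor F 0"
      unfolding F(3)[OF i'(1) f(2)] i'(2) comp_assoc[OF \<beta>(1) i F(1)[OF f(2)], symmetric] fi
        comp_zero_left[OF \<beta>(1)] linear_functor_zero[OF quasi_inverse_functor(1)[OF assms(1)]] ..
    then have "f \<cdot> i' = 0"
      by (rule quasi_inverse_faithful[OF assms(1) comp_in_Hom[OF i'(1) f(2)] zero_in_Hom])
    then have "zero_object T (ob G W)" using min_right_approximationD(2)[OF min i'(1) p'(1) pi'] by blast
    then have "idm T (ob F (ob G W)) = 0"
      using F(2)[of "ob G W"] linear_functor_zero[OF quasi_inverse_functor(1)[OF assms(1)]]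
      unfolding zero_object_iff by simp
    then have "\<beta> = 0" using comp_idm[OF \<beta>(1)] comp_zero_right[OF \<beta>(1)] by simp
    then show ?thesis using \<beta>(3) comp_zero_left[OF \<beta>(2)] unfolding zero_object_iff by simp
  qed
  ultimately show ?thesis unfolding min_right_approximation_def by blast
qed

text \<open>
  Write the map \<open>f: C1 \<rightarrow> W \<rightarrow> C0'\<close> as \<open>k \<cdot> a + a' \<cdot> l\<close>, which is possible because \<open>ext_zero A A'\<close>.
  As \<open>W\<close> is local, one of the two terms is an isomorphism on \<open>W\<close>, against minimality of one
  of the approximations.
\<close>

lemma no_common_summand:
  assumes t: "tri T C1 C0 A a g w" and t': "tri T C1' C0' A' a' g' w'"
    and min: "min_right_approximation \<C> A C0 g" and min': "min_right_approximation \<C> A' C0' g'"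
    and ext: "ext_zero A A'" and W: "local_End T W" "retract W C1" "retract W C0'"
  shows False
proof -
  note H = triD[OF t] and H' = triD[OF t']
  obtain \<iota> \<pi> where \<iota>: "\<iota> \<in> Hom T W C1" "\<pi> \<in> Hom T C1 W" "\<pi> \<cdot> \<iota> = idm T W"
    using W(2) by (rule retractE)
  obtain \<iota>' \<pi>' where \<iota>': "\<iota>' \<in> Hom T W C0'" "\<pi>' \<in> Hom T C0' W" "\<pi>' \<cdot> \<iota>' = idm T W"
    using W(3) by (rule retractE)
  note approx = right_approximationD[OF min_right_approximationD(1)[OF min]]
    and approx' = right_approximationD[OF min_right_approximationD(1)[OF min']]
  define f where "f = \<iota>' \<cdot> \<pi>"
  have f: "f \<in> Hom T C1 C0'" unfolding f_def by (rule comp_in_Hom[OF \<iota>(2) \<iota>'(1)])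
  note g'f = comp_in_Hom[OF f H'(2)]
  \<comment> \<open>Ext-vanishing extends \<open>g' \<cdot> f\<close> along \<open>a\<close>, and
    the approximation \<open>g'\<close> lifts the extension to \<open>k\<close>. The remainder
    \<open>f - k \<cdot> a\<close> is killed by \<open>g'\<close>, so it factors through
    \<open>a'\<close>.\<close>
  have "shm (g' \<cdot> f) \<cdot> w = 0" by (rule ext_zeroD[OF ext comp_in_Hom[OF H(3) shm_in_Hom[OF g'f]]])
  then obtain h where h: "h \<in> Hom T C0 A'" "g' \<cdot> f = h \<cdot> a" using tri_extend3[OF t g'f] by blast
  obtain k where k: "k \<in> Hom T C0 C0'" "h = g' \<cdot> k" using approx'(3)[OF approx(1) h(1)] by blast
  note ka = comp_in_Hom[OF H(1) k(1)]
  have "g' \<cdot> (f - k \<cdot> a) = 0"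
    unfolding comp_diff_right[OF f ka H'(2)] h(2) k(2) comp_assoc[OF H(1) k(1) H'(2)] by simp
  then obtain l where l: "l \<in> Hom T C1 C1'" "f - k \<cdot> a = a' \<cdot> l"
    using tri_lift[OF t' diff_in_Hom[OF f ka]] by blast
  note a\<iota> = comp_in_Hom[OF \<iota>(1) H(1)] and l\<iota> = comp_in_Hom[OF \<iota>(1) l(1)] and \<pi>k = comp_in_Hom[OF k(1) \<iota>'(2)]
  note al\<iota> = comp_in_Hom[OF l\<iota> H'(1)]
  have nz: "\<not> zero_object T W" using W(1) unfolding local_End_def zero_object_iff by blast
  have f_eq: "f = k \<cdot> a + a' \<cdot> l" unfolding l(2)[symmetric] by simp
  have "f \<cdot> \<iota> = \<iota>'" unfolding f_def comp_assoc[OF \<iota>(1,2) \<iota>'(1)] \<iota>(3) by (rule comp_idm[OF \<iota>'(1)])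
  moreover have "f \<cdot> \<iota> = k \<cdot> (a \<cdot> \<iota>) + a' \<cdot> (l \<cdot> \<iota>)"
    unfolding f_eq comp_add_left[OF \<iota>(1) ka comp_in_Hom[OF l(1) H'(1)]]
      comp_assoc[OF \<iota>(1) H(1) k(1)] comp_assoc[OF \<iota>(1) l(1) H'(1)] ..
  ultimately have "idm T W = \<pi>' \<cdot> (k \<cdot> (a \<cdot> \<iota>) + a' \<cdot> (l \<cdot> \<iota>))" using \<iota>'(3) by simp
  also have "\<dots> = (\<pi>' \<cdot> k) \<cdot> (a \<cdot> \<iota>) + \<pi>' \<cdot> (a' \<cdot> (l \<cdot> \<iota>))"
    unfolding comp_add_right[OF comp_in_Hom[OF a\<iota> k(1)] al\<iota> \<iota>'(2)] comp_assoc[OF a\<iota> k(1) \<iota>'(2)] ..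
  finally have "iso T W W ((\<pi>' \<cdot> k) \<cdot> (a \<cdot> \<iota>) + \<pi>' \<cdot> (a' \<cdot> (l \<cdot> \<iota>)))" using iso_idm[of W] by simp
  then consider "iso T W W ((\<pi>' \<cdot> k) \<cdot> (a \<cdot> \<iota>))" | "iso T W W (\<pi>' \<cdot> (a' \<cdot> (l \<cdot> \<iota>)))"
    using local_End_add[OF W(1) comp_in_Hom[OF a\<iota> \<pi>k] comp_in_Hom[OF al\<iota> \<iota>'(2)]] by blast
  then show False
  proof cases
    \<comment> \<open>Here \<open>a \<cdot> \<iota>\<close> is a split monomorphism killed by
      \<open>g\<close>, against minimality of \<open>g\<close>. The other case is the same with
      \<open>a' \<cdot> (l \<cdot> \<iota>)\<close> and \<open>g'\<close>.\<close>
    case 1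
    then obtain \<beta> where \<beta>: "\<beta> \<in> Hom T W W" "\<beta> \<cdot> ((\<pi>' \<cdot> k) \<cdot> (a \<cdot> \<iota>)) = idm T W" by (rule isoE)
    have "(\<beta> \<cdot> (\<pi>' \<cdot> k)) \<cdot> (a \<cdot> \<iota>) = idm T W" unfolding comp_assoc[OF a\<iota> \<pi>k \<beta>(1)] by (rule \<beta>(2))
    moreover have "g \<cdot> (a \<cdot> \<iota>) = 0"
      unfolding comp_assoc[OF \<iota>(1) H(1,2), symmetric] tri_comp_zero[OF t] by (rule comp_zero_left[OF \<iota>(1)])
    ultimately show False
      using min_right_approximationD(2)[OF min a\<iota> comp_in_Hom[OF \<pi>k \<beta>(1)]] nz by blast
  next
    case 2
    then obtain \<beta> where \<beta>: "\<beta> \<in> Hom T W W" "\<beta> \<cdot> (\<pi>' \<cdot> (a' \<cdot> (l \<cdot> \<iota>))) = idm T W" by (rule isoE)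
    have "(\<beta> \<cdot> \<pi>') \<cdot> (a' \<cdot> (l \<cdot> \<iota>)) = idm T W" unfolding comp_assoc[OF al\<iota> \<iota>'(2) \<beta>(1)] by (rule \<beta>(2))
    moreover have "g' \<cdot> (a' \<cdot> (l \<cdot> \<iota>)) = 0"
      unfolding comp_assoc[OF l\<iota> H'(1,2), symmetric] tri_comp_zero[OF t'] by (rule comp_zero_left[OF l\<iota>])
    ultimately show False
      using min_right_approximationD(2)[OF min' al\<iota> comp_in_Hom[OF \<iota>'(2) \<beta>(1)]] nz by blast
  qed
qed

section \<open>Serre duality\<close>

text \<open>Extend the assignment of 1 to \<open>v\<close> linearly to the ambient space, then
  restrict, since \<open>dual_space\<close> consists of extensional functions.\<close>

lemma ex_dual_nonzero:
  assumes "v \<in> Hom T X Y" "v \<noteq> 0"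
  obtains \<phi> where "\<phi> \<in> dual_space (scal T) (Hom T X Y)" "\<phi> v = 1"
proof -
  interpret vs: vector_space "scal T" by (rule vector_space)
  interpret fs: vector_space "(*) :: 'k \<Rightarrow> 'k \<Rightarrow> 'k" by standard (simp_all add: algebra_simps)
  interpret pair: vector_space_pair "scal T" "(*) :: 'k \<Rightarrow> 'k \<Rightarrow> 'k" ..
  have "vs.independent {v}" using assms(2) by simp
  then obtain \<phi> where \<phi>: "Vector_Spaces.linear (scal T) (*) \<phi>" "\<phi> v = 1"
    using pair.linear_independent_extend[of "{v}" "\<lambda>_. 1"] by blast
  interpret \<phi>: Vector_Spaces.linear "scal T" "(*)" \<phi> by (rule \<phi>(1))
  have "scal T c f \<in> Hom T X Y" if "f \<in> Hom T X Y" for c f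
    using that subspace_Hom vs.subspace_scale by blast
  then have "restrict \<phi> (Hom T X Y) \<in> dual_space (scal T) (Hom T X Y)"
    unfolding dual_space_def by (auto simp: add_in_Hom \<phi>.add \<phi>.scale)
  then show ?thesis using that \<phi>(2) assms(1) by fastforce
qed

text \<open>A space is zero exactly if its dual is a single point, and \<open>\<eta>\<close> is a
  bijection from (X, Y) onto the dual of (Y, SX).\<close>

lemma serre_zero:
  assumes "serre_functor T S S'"
  shows "Hom T X Y = {0} \<longleftrightarrow> Hom T Y (ob S X) = {0}"
proof -
  let ?V = "Hom T Y (ob S X)"
  have "\<exists>\<eta>. \<forall>X Y. bij_betw (\<eta> X Y) (Hom T X Y) (dual_space (scal T) (Hom T Y (ob S X)))"
    using assms unfolding serre_functor_def by (elim conjE exE) (rule exI)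
  then obtain \<eta> where \<eta>: "bij_betw \<eta> (Hom T X Y) (dual_space (scal T) ?V)" by blast
  show ?thesis
  proof
    assume zero: "Hom T X Y = {0}"
    have "v = 0" if v: "v \<in> ?V" for v
    proof (rule ccontr)
      assume "v \<noteq> 0"
      then obtain \<phi> where \<phi>: "\<phi> \<in> dual_space (scal T) ?V" "\<phi> v = 1" using ex_dual_nonzero[OF v] by blast
      interpret vs: vector_space "scal T" by (rule vector_space)
      have "scal T c f \<in> ?V" if "f \<in> ?V" for c f using that subspace_Hom vs.subspace_scale by blast
      then have "restrict (\<lambda>_. 0) ?V \<in> dual_space (scal T) ?V"
        unfolding dual_space_def by (auto simp: add_in_Hom)
      moreover have "dual_space (scal T) ?V = {\<eta> 0}" using \<eta> zero unfolding bij_betw_def by simp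
      ultimately have "restrict (\<lambda>_. 0) ?V = \<phi>" using \<phi>(1) by simp
      then show False using \<phi>(2) v by auto
    qed
    then show "?V = {0}" unfolding Hom_eq_zero_iff by blast
  next
    assume zero: "?V = {0}"
    have eq: "\<phi> = \<psi>" if "\<phi> \<in> dual_space (scal T) ?V" "\<psi> \<in> dual_space (scal T) ?V" for \<phi> \<psi>
    proof
      fix x
      have "\<phi> (0 + 0) = \<phi> 0 + \<phi> 0" "\<psi> (0 + 0) = \<psi> 0 + \<psi> 0"
        using that zero_in_Hom unfolding dual_space_def by blast+
      then have "\<phi> 0 = 0" "\<psi> 0 = 0" by (metis add_0 add_cancel_right_right)+
      moreover have "\<phi> \<in> extensional ?V" "\<psi> \<in> extensional ?V" using that unfolding dual_space_def by blast+
      ultimately show "\<phi> x = \<psi> x" using zero by (cases "x = 0") (auto simp: extensional_def)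
    qed
    have "f = 0" if f: "f \<in> Hom T X Y" for f
      using eq[OF bij_betwE[OF \<eta>, rule_format, OF f] bij_betwE[OF \<eta>, rule_format, OF zero_in_Hom]]
      by (rule inj_onD[OF bij_betw_imp_inj_on[OF \<eta>] _ f zero_in_Hom])
    then show "Hom T X Y = {0}" unfolding Hom_eq_zero_iff by blast
  qed
qed

lemma serre_quasi_inverse: "serre_functor T S S' \<Longrightarrow> quasi_inverse T S S'"
  unfolding serre_functor_def by blast

lemma S2_quasi_inverse:
  assumes "serre_functor T S S'"
  shows "quasi_inverse T (S2 T S) (S2_inv T S')"
proof -
  note u = quasi_inverse_sym[OF shift_unshift]
  have "quasi_inverse T (S \<odot> unshift T \<odot> unshift T) ((shift T \<odot> shift T) \<odot> S')"
    by (rule quasi_inverse_comp[OF serre_quasi_inverse[OF assms] quasi_inverse_comp[OF u u]])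
  then show ?thesis unfolding S2_def S2_inv_def functor_comp_def by simp
qed

text \<open>The vanishing form of the duality between Ext^1(X, Y) and Ext^1(Y, S_2 X).\<close>

lemma ext_zero_S2:
  assumes "serre_functor T S S'"
  shows "ext_zero X Y \<longleftrightarrow> ext_zero Y (ob (S2 T S) X)"
proof -
  let ?u = "ob (unshift T)"
  note u = quasi_inverse_sym[OF shift_unshift]
  have "ext_zero X Y \<longleftrightarrow> Hom T (?u X) Y = {0}"
    unfolding ext_zero_def by (rule quasi_inverse_adjoint_zero[OF u, symmetric])
  \<comment> \<open>One more desuspension lets Serre duality produce \<open>S\<close> applied to
    X[-2], which is \<open>S2\<close> as defined; \<open>S\<close> never has to be commuted with the
    shift.\<close>
  also have "\<dots> \<longleftrightarrow> Hom T (?u (?u X)) (?u Y) = {0}" by (rule quasi_inverse_Hom_zero[OF u, symmetric])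
  also have "\<dots> \<longleftrightarrow> Hom T (?u Y) (ob S (?u (?u X))) = {0}" by (rule serre_zero[OF assms])
  also have "\<dots> \<longleftrightarrow> Hom T Y (sh (ob S (?u (?u X)))) = {0}" by (rule quasi_inverse_adjoint_zero[OF u])
  finally show ?thesis unfolding ext_zero_def S2_def functor_comp_def by simp
qed

lemma ext_zero_S2_inv:
  assumes "serre_functor T S S'"
  shows "ext_zero (ob (S2_inv T S') X) Y \<longleftrightarrow> ext_zero Y X"
  unfolding ext_zero_S2[OF assms, of "ob (S2_inv T S') X"]
  by (rule ext_zero_isomorphic[OF isomorphic_refl
        quasi_inverse_isomorphic[OF quasi_inverse_sym[OF S2_quasi_inverse[OF assms]]]])

text \<open>Duality exchanges the two sides of Ext, so orthogonality of \<open>X\<close> to \<U> on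
  one side becomes orthogonality of its image on the other.\<close>

lemma ext_closed_S2:
  assumes "serre_functor T S S'" "\<U> = ext_right \<U>" "\<U> = ext_left \<U>" "X \<in> \<U>"
  shows "ob (S2 T S) X \<in> \<U>" "ob (S2_inv T S') X \<in> \<U>"
proof -
  have "ext_zero X A" "ext_zero A X" if "A \<in> \<U>" for A
    using that assms(2-4) unfolding ext_right_def ext_left_def by blast+
  then have "ob (S2 T S) X \<in> ext_right \<U>" "ob (S2_inv T S') X \<in> ext_left \<U>"
    unfolding ext_right_def ext_left_def using ext_zero_S2[OF assms(1)] ext_zero_S2_inv[OF assms(1)] by blast+
  then show "ob (S2 T S) X \<in> \<U>" "ob (S2_inv T S') X \<in> \<U>" using assms(2,3) by blast+
qed

text \<open>Ext^1(D, A) vanishes exactly if Ext^1(A, S_2 D) does, and the objects S_2 D exhaust \<D>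
  up to isomorphism.\<close>

lemma S2_subcategory_ext_right:
  assumes "serre_functor T S S'" "S2_subcategory T S S' \<D>"
  shows "ext_right \<D> = ext_left \<D>"
proof -
  have image: "\<D> = functor_image T (S2 T S) \<D>" using assms(2) unfolding S2_subcategory_def by blast
  have S2D: "ob (S2 T S) D \<in> \<D>" if "D \<in> \<D>" for D
    using that image isomorphic_refl unfolding functor_image_def by blast
  have ess: "\<exists>D'\<in>\<D>. isomorphic T (ob (S2 T S) D') D" if "D \<in> \<D>" for D
    using that image unfolding functor_image_def by blast
  show ?thesis
  proof (intro set_eqI iffI)
    fix A assume A: "A \<in> ext_right \<D>"
    have "ext_zero A D" if D: "D \<in> \<D>" for D
    proof -
      obtain D' where D': "D' \<in> \<D>" "isomorphic T (ob (S2 T S) D') D" using ess[OF D] by blast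
      then have "ext_zero A (ob (S2 T S) D')" using A ext_zero_S2[OF assms(1)] unfolding ext_right_def by blast
      then show ?thesis using ext_zero_isomorphic[OF isomorphic_refl D'(2)] by blast
    qed
    then show "A \<in> ext_left \<D>" unfolding ext_left_def by blast
  next
    fix A assume "A \<in> ext_left \<D>"
    then show "A \<in> ext_right \<D>"
      unfolding ext_left_def ext_right_def using S2D ext_zero_S2[OF assms(1)] by blast
  qed
qed

section \<open>The two cluster tilting subcategories\<close>

text \<open>Equivalences carry minimal approximations to minimal approximations. So the set
  \<open>Q\<close> of summands of their sources is stable under \<open>F\<close> and
  \<open>G\<close>, and membership is constant along orbits.\<close>

lemma approximation_summand_orbit:
  assumes "quasi_inverse T F G" "subcategory T \<C>"
    and C: "\<forall>X\<in>\<C>. ob F X \<in> \<C> \<and> ob G X \<in> \<C>" and Y: "\<forall>A\<in>\<Y>. ob F A \<in> \<Y> \<and> ob G A \<in> \<Y>"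
  defines "Q \<equiv> {V. \<exists>A\<in>\<Y>. \<exists>X f. min_right_approximation \<C> A X f \<and> retract V X}"
  shows "isomorphic T V V' \<Longrightarrow> V \<in> Q \<longleftrightarrow> V' \<in> Q"
    and "(ob F ^^ n) V \<in> Q \<longleftrightarrow> V \<in> Q" and "(ob G ^^ n) V \<in> Q \<longleftrightarrow> V \<in> Q"
proof -
  note qi = assms(1) and qi' = quasi_inverse_sym[OF assms(1)]
  note min_F = min_right_approximation_equivalence[OF qi assms(2) bspec[OF C, THEN conjunct1] bspec[OF C, THEN conjunct2]]
    and min_G = min_right_approximation_equivalence[OF qi' assms(2) bspec[OF C, THEN conjunct2] bspec[OF C, THEN conjunct1]]
  have retract: "V' \<in> Q" if "V \<in> Q" "retract V' V" for V V'
    using that retract_trans unfolding Q_def by blast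
  then show iso: "V \<in> Q \<longleftrightarrow> V' \<in> Q" if "isomorphic T V V'" for V V'
    using that isomorphic_imp_retract isomorphic_sym by blast
  have F: "ob F V \<in> Q" if V: "V \<in> Q" for V
  proof -
    obtain A X f where "A \<in> \<Y>" "min_right_approximation \<C> A X f" "retract V X"
      using V unfolding Q_def by blast
    then show ?thesis
      using Y min_F
        linear_functor_retract[OF quasi_inverse_functor(1)[OF qi]] unfolding Q_def by blast
  qed
  have G: "ob G V \<in> Q" if V: "V \<in> Q" for V
  proof -
    obtain A X f where "A \<in> \<Y>" "min_right_approximation \<C> A X f" "retract V X"
      using V unfolding Q_def by blast
    then show ?thesis
      using Y min_G
        linear_functor_retract[OF quasi_inverse_functor(1)[OF qi']] unfolding Q_def by blast
  qed
  have "ob F V \<in> Q \<longleftrightarrow> V \<in> Q" for V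
    using F G iso[OF quasi_inverse_isomorphic[OF qi]] by blast
  then show "(ob F ^^ n) V \<in> Q \<longleftrightarrow> V \<in> Q" by (induction n) simp_all
  have "ob G V \<in> Q \<longleftrightarrow> V \<in> Q" for V
    using F G iso[OF quasi_inverse_isomorphic[OF qi']] by blast
  then show "(ob G ^^ n) V \<in> Q \<longleftrightarrow> V \<in> Q" by (induction n) simp_all
qed

end

context mutation_base
begin

text \<open>An \<open>A\<close> outside \<C> yields a local summand \<open>W\<close> of its
  \<open>C1\<close>, an \<open>A'\<close> outside the shift one of its \<open>C0'\<close>, both
  outside \<D>. They lie in the same orbit, so \<open>W\<close> also occurs in the approximation of
  some object of \<Y>, against \<open>no_common_summand\<close>.\<close>

lemma orbit_dichotomy:
  assumes fin: "hom_finite T" "krull_schmidt T" and serre: "serre_functor T S S'"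
    and C: "subcategory T \<C>" "functorially_finite T \<C>" "\<C> = ext_right \<C>" "\<C> = ext_left \<C>" "\<D> \<subseteq> \<C>"
    and orbit: "ind T \<C> - ind T \<D> = S2_orbit T S S' X"
    and Y: "\<Y> = ext_right \<Y>" "\<Y> = ext_left \<Y>" "\<Y> \<subseteq> \<Z>"
  shows "\<Y> \<subseteq> \<C> \<or> \<Y> \<subseteq> shift_up \<C>"
proof (rule ccontr)
  assume "\<not> ?thesis"
  then obtain A A' where A: "A \<in> \<Y>" "A \<notin> \<C>" and A': "A' \<in> \<Y>" "A' \<notin> shift_up \<C>" by blast
  note qi = S2_quasi_inverse[OF serre]
  have CS: "\<forall>B\<in>\<C>. ob (S2 T S) B \<in> \<C> \<and> ob (S2_inv T S') B \<in> \<C>"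
    and YS: "\<forall>B\<in>\<Y>. ob (S2 T S) B \<in> \<Y> \<and> ob (S2_inv T S') B \<in> \<Y>"
    using ext_closed_S2[OF serre C(3,4)] ext_closed_S2[OF serre Y(1,2)] by blast+
  note CZ = subset_Z[OF C(3,5)]
  have rigidC: "ext_zero B B'" if "B \<in> \<C>" "B' \<in> \<C>" for B B' using that C(3) ext_right_iff by blast
  have rigidY: "ext_zero B B'" if "B \<in> \<Y>" "B' \<in> \<Y>" for B B' using that Y(1) ext_right_iff by blast
  define Q where "Q = {V. \<exists>A\<in>\<Y>. \<exists>X f. min_right_approximation \<C> A X f \<and> retract V X}"
  note Q = approximation_summand_orbit[OF qi C(1) CS YS, folded Q_def]
  have ex_min: "\<exists>C0 C1 a g w. min_right_approximation \<C> B C0 g \<and> tri T C1 C0 B a g w \<and> C0 \<in> \<C> \<and> C1 \<in> \<C>" for B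
  proof -
    obtain X0 f0 where "right_approximation T \<C> B X0 f0" using C(2) unfolding functorially_finite_def by blast
    then obtain C0 g where min: "min_right_approximation \<C> B C0 g"
      using ex_min_right_approximation[OF fin(1) C(1)] by blast
    note g = right_approximationD[OF min_right_approximationD(1)[OF min]]
    obtain C1 a w where t: "tri T C1 C0 B a g w" using ex_tri_cocone[OF g(2)] by blast
    have "ext_zero V C1" if "V \<in> \<C>" for V by (rule cocone_ext_zero[OF t rigidC[OF that g(1)] g(3)[OF that]])
    then have "C1 \<in> ext_right \<C>" unfolding ext_right_iff by blast
    then have "C1 \<in> \<C>" using C(3) by simp
    then show ?thesis using min t g(1) by blast
  qed
  \<comment> \<open>The local objects of \<C> outside \<D> all lie in the orbit of \<open>X\<close>,
    so \<open>Q\<close> contains all of them or none.\<close>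
  have Q_iff: "W \<in> Q \<longleftrightarrow> X \<in> Q" if W: "local_End T W" "W \<in> \<C>" "W \<notin> \<D>" for W
  proof -
    have "iso_class T W \<in> ind T \<C>"
      unfolding ind_def using W(2) local_End_imp_indecomposable[OF W(1)] by blast
    moreover have "iso_class T W \<notin> ind T \<D>"
    proof
      assume "iso_class T W \<in> ind T \<D>"
      then obtain V where "iso_class T V = iso_class T W" "V \<in> \<D>" unfolding ind_def by auto
      then show False using subcategory_isomorphic[OF subcategory_D iso_class_eqD] W(3) by blast
    qed
    ultimately have "iso_class T W \<in> S2_orbit T S S' X" using orbit by blast
    then obtain n where "iso_class T W = iso_class T ((ob (S2 T S) ^^ n) X) \<or>
        iso_class T W = iso_class T ((ob (S2_inv T S') ^^ n) X)"
      unfolding S2_orbit_def by blast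
    then show ?thesis
    proof
      assume "iso_class T W = iso_class T ((ob (S2 T S) ^^ n) X)"
      then show ?thesis using Q(1)[OF iso_class_eqD] Q(2) by blast
    next
      assume "iso_class T W = iso_class T ((ob (S2_inv T S') ^^ n) X)"
      then show ?thesis using Q(1)[OF iso_class_eqD] Q(3) by blast
    qed
  qed
  obtain C0 C1 a g w where m: "min_right_approximation \<C> A C0 g" and t: "tri T C1 C0 A a g w"
    and C01: "C0 \<in> \<C>" "C1 \<in> \<C>" using ex_min by blast
  obtain C0' C1' a' g' w' where m': "min_right_approximation \<C> A' C0' g'" and t': "tri T C1' C0' A' a' g' w'"
    and C01': "C0' \<in> \<C>" "C1' \<in> \<C>" using ex_min by blast
  \<comment> \<open>Otherwise \<open>A\<close>, lying in \<Z>, splits the triangle and is a summand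
    of \<open>C0\<close>, hence in \<C>.\<close>
  have "C1 \<notin> \<D>"
  proof
    assume "C1 \<in> \<D>"
    then have "Hom T A (sh C1) = {0}" using A(1) Y(3) Z_left unfolding Hom_eq_zero_iff by blast
    then show False using subcategory_retract[OF C(1) tri_split(1)[OF t] C01(1)] A(2) by blast
  qed
  then obtain W where W: "local_End T W" "retract W C1" "W \<notin> \<D>"
    using krull_schmidt_summand[OF fin(2) subcategory_D] by blast
  \<comment> \<open>Otherwise the approximation triangle itself exhibits \<open>A'\<close> as a
    shift of \<open>C1'\<close>.\<close>
  have "C0' \<notin> \<D>"
  proof
    assume "C0' \<in> \<D>"
    then have "cosyzygy C1' A'" unfolding cosyzygy_def using C01'(2) CZ A'(1) Y(3) t' by blast
    then show False using A'(2) C01'(2) unfolding shift_up_def by blast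
  qed
  then obtain W' where W': "local_End T W'" "retract W' C0'" "W' \<notin> \<D>"
    using krull_schmidt_summand[OF fin(2) subcategory_D] by blast
  have "W' \<in> Q" unfolding Q_def using A'(1) m' W'(2) by blast
  then have "W \<in> Q"
    using Q_iff W W' subcategory_retract[OF C(1)] C01(2) C01'(1) by blast
  then obtain B V f where B: "B \<in> \<Y>" "min_right_approximation \<C> B V f" "retract W V"
    unfolding Q_def by blast
  obtain U u v where "tri T U V B u f v"
    using ex_tri_cocone[OF right_approximationD(2)[OF min_right_approximationD(1)[OF B(2)]]] by blast
  then show False by (rule no_common_summand[OF t _ m B(2) rigidY[OF A(1) B(1)] W(1,2) B(3)])
qed

section \<open>From the shifts to mutation pairs\<close>

lemma left_perp_D: "left_perp T (functor_image T (shift T) \<D>) = \<Z>"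
  and right_perp_D: "right_perp T (functor_image T (unshift T) \<D>) = \<Z>"
  unfolding left_perp_eq right_perp_eq \<Z>_def ext_right_D by (rule refl)+

lemma shift_up_subset_mu_inv: "shift_up \<U> \<subseteq> mu_inv T \<U> \<D>"
proof
  fix B assume "B \<in> shift_up \<U>"
  then obtain A where A: "A \<in> \<U>" "cosyzygy A B" unfolding shift_up_def by blast
  obtain D u v w where t: "B \<in> \<Z>" "D \<in> \<D>" "tri T A D B u v w" using A(2) by (rule cosyzygyE)
  have "sh A \<in> functor_image T (shift T) \<U>" unfolding functor_image_def using A(1) isomorphic_refl by blast
  then have "B \<in> star T \<D> (functor_image T (shift T) \<U>)"
    unfolding star_def using t(2) rotate[OF t(3)] by blast
  then show "B \<in> mu_inv T \<U> \<D>" unfolding mu_inv_def left_perp_D using t(1) by blast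
qed

text \<open>\<open>B\<close> is replaced by the shift of its desuspension, and the triangle is
  rotated backwards to start at B[-1].\<close>

lemma shift_down_subset_mu: "shift_down \<U> \<subseteq> mu T \<U> \<D>"
proof
  fix A assume "A \<in> shift_down \<U>"
  then obtain B where B: "B \<in> \<U>" "cosyzygy A B" unfolding shift_down_def by blast
  obtain D u v w where t: "A \<in> \<Z>" "D \<in> \<D>" "tri T A D B u v w" using B(2) by (rule cosyzygyE)
  obtain v' w' where "tri T A D (sh (ob (unshift T) B)) u v' w'"
    using tri_iso_right[OF t(3) isomorphic_sym[OF sh_unshift]] by blast
  then obtain x where x: "tri T (ob (unshift T) B) A D x u v'" by (rule unrotate)
  have "ob (unshift T) B \<in> functor_image T (unshift T) \<U>"
    unfolding functor_image_def using B(1) isomorphic_refl by blast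
  then have "A \<in> star T (functor_image T (unshift T) \<U>) \<D>"
    unfolding star_def using t(2) x by blast
  then show "A \<in> mu T \<U> \<D>" unfolding mu_def right_perp_D using t(1) by blast
qed

text \<open>\<open>ext_right\<close> reverses inclusions, so its fixed points are never properly
  nested.\<close>

lemma rigid_subset_eq:
  assumes "\<Y> = ext_right \<Y>" "\<Y> \<subseteq> \<U>" "\<U> = ext_right \<U>"
  shows "\<Y> = \<U>"
  using assms ext_right_mono[OF assms(2)] by blast

lemma exactly_two_cluster_tilting:
  assumes fin: "hom_finite T" "krull_schmidt T" and serre: "serre_functor T S S'"
    and ct: "two_cluster_tilting T \<C>" "\<D> \<subseteq> \<C>"
    and orbit: "ind T \<C> - ind T \<D> = S2_orbit T S S' X" and X: "indecomposable T X"
  shows "\<C> \<noteq> shift_up \<C>" "{\<Y>. two_cluster_tilting T \<Y> \<and> \<D> \<subseteq> \<Y>} = {\<C>, shift_up \<C>}"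
    "mutation_pair T \<D> \<C> (shift_up \<C>)" "mutation_pair T \<D> (shift_up \<C>) \<C>"
proof -
  have C: "subcategory T \<C>" "functorially_finite T \<C>" "\<C> = ext_right \<C>" "\<C> = ext_left \<C>"
    using ct(1) unfolding two_cluster_tilting_iff by blast+
  note CZ = subset_Z[OF C(3) ct(2)]
  have rigidC: "ext_zero B B'" if "B \<in> \<C>" "B' \<in> \<C>" for B B' using that C(3) ext_right_iff by blast
  note dichotomy = orbit_dichotomy[OF fin serre C ct(2) orbit]
  \<comment> \<open>\<open>X\<close> lies in its own orbit, by the power 0, and so represents a
    class of \<C> outside \<D>.\<close>
  have "iso_class T X = iso_class T ((ob (S2 T S) ^^ 0) X)" by simp
  then have "iso_class T X \<in> S2_orbit T S S' X" unfolding S2_orbit_def by blast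
  then have "iso_class T X \<in> ind T \<C>" "iso_class T X \<notin> ind T \<D>" using orbit by blast+
  then obtain X' where X': "X' \<in> \<C>" "iso_class T X' = iso_class T X" and XD: "X \<notin> \<D>"
    using X unfolding ind_def by auto
  have XC: "X \<in> \<C>" by (rule subcategory_isomorphic[OF C(1) iso_class_eqD[OF X'(2)] X'(1)])
  obtain B where B: "cosyzygy X B" using ex_cosyzygy_right XC CZ by blast
  obtain A where A: "cosyzygy A X" using ex_cosyzygy_left XC CZ by blast
  \<comment> \<open>Otherwise rigidity splits the triangle X -> D -> B and makes \<open>X\<close> a
    summand of an object of \<D>.\<close>
  have "B \<notin> \<C>"
  proof
    assume "B \<in> \<C>"
    then have ext: "Hom T B (sh X) = {0}" using rigidC[OF _ XC] unfolding ext_zero_def by blast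
    obtain D u v w where "D \<in> \<D>" "tri T X D B u v w" using B by (rule cosyzygyE)
    then show False using subcategory_retract[OF subcategory_D tri_split(2)[OF _ ext]] XD by blast
  qed
  then show neq: "\<C> \<noteq> shift_up \<C>" using B XC unfolding shift_up_def by blast
  have "A \<notin> \<C>"
  proof
    assume "A \<in> \<C>"
    then have ext: "Hom T X (sh A) = {0}" using rigidC[OF XC] unfolding ext_zero_def by blast
    obtain D u v w where "D \<in> \<D>" "tri T A D X u v w" using A by (rule cosyzygyE)
    then show False using subcategory_retract[OF subcategory_D tri_split(1)[OF _ ext]] XD by blast
  qed
  then have down_not: "\<not> shift_down \<C> \<subseteq> \<C>" using A XC unfolding shift_down_def by blast
  note up_ct = two_cluster_tilting_shift_up[OF ct]
  have N: "subcategory T (shift_up \<C>)" "shift_up \<C> = ext_right (shift_up \<C>)"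
    using up_ct unfolding two_cluster_tilting_iff by blast+
  note closed = shift_down_ext_closed[OF C(1) ct(2) C(3,4)]
  have "shift_down \<C> \<subseteq> \<Z>" unfolding shift_down_def cosyzygy_def by blast
  \<comment> \<open>At this point \<open>shift_down \<C>\<close> is known to equal both of its
    Ext-perpendiculars, which is the form the dichotomy asks for. The object \<open>A\<close>
    excludes the first alternative.\<close>
  then have "shift_down \<C> \<subseteq> shift_up \<C>" using dichotomy[OF closed] down_not by blast
  then have down_eq: "shift_down \<C> = shift_up \<C>" by (rule rigid_subset_eq[OF closed(1) _ N(2)])
  note DN = D_subset_shifts[OF C(1)]
  show "{\<Y>. two_cluster_tilting T \<Y> \<and> \<D> \<subseteq> \<Y>} = {\<C>, shift_up \<C>}"
  proof (intro set_eqI iffI)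
    fix \<Y> assume "\<Y> \<in> {\<Y>. two_cluster_tilting T \<Y> \<and> \<D> \<subseteq> \<Y>}"
    then have Y: "\<Y> = ext_right \<Y>" "\<Y> = ext_left \<Y>" "\<D> \<subseteq> \<Y>"
      unfolding two_cluster_tilting_iff by blast+
    \<comment> \<open>The dichotomy puts \<Y> inside one of the two, and proper inclusion is
      impossible.\<close>
    show "\<Y> \<in> {\<C>, shift_up \<C>}"
      using dichotomy[OF Y(1,2) subset_Z[OF Y(1,3)]] rigid_subset_eq[OF Y(1) _ C(3)]
        rigid_subset_eq[OF Y(1) _ N(2)] by blast
  next
    fix \<Y> assume "\<Y> \<in> {\<C>, shift_up \<C>}"
    then show "\<Y> \<in> {\<Y>. two_cluster_tilting T \<Y> \<and> \<D> \<subseteq> \<Y>}" using ct up_ct DN(1) by auto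
  qed
  have rigid: "two_rigid T \<D>" unfolding two_rigid_iff using rigid_D by blast
  have C_up_down: "\<C> \<subseteq> shift_down (shift_up \<C>)"
  proof
    fix V assume V: "V \<in> \<C>"
    then obtain W where "cosyzygy V W" using ex_cosyzygy_right CZ by blast
    then show "V \<in> shift_down (shift_up \<C>)" using V unfolding shift_down_def shift_up_def by blast
  qed
  show "mutation_pair T \<D> \<C> (shift_up \<C>)"
    unfolding mutation_pair_def
    by (intro conjI subcategory_D rigid C(1) N(1) ct(2) DN(1) shift_up_subset_mu_inv
        subset_trans[OF C_up_down shift_down_subset_mu])
  have "\<C> \<subseteq> shift_up (shift_down \<C>)"
  proof
    fix V assume V: "V \<in> \<C>"
    then obtain W where "cosyzygy W V" using ex_cosyzygy_left CZ by blast
    then show "V \<in> shift_up (shift_down \<C>)" using V unfolding shift_down_def shift_up_def by blast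
  qed
  \<comment> \<open>Since both shifts of \<C> coincide, shifting \<open>shift_up \<C>\<close> up
    once more gives back the objects of \<C>.\<close>
  then have "\<C> \<subseteq> mu_inv T (shift_up \<C>) \<D>"
    using shift_up_subset_mu_inv[of "shift_up \<C>"] unfolding down_eq by (rule subset_trans)
  moreover have "shift_up \<C> \<subseteq> mu T \<C> \<D>"
    using shift_down_subset_mu[of \<C>] unfolding down_eq .
  ultimately show "mutation_pair T \<D> (shift_up \<C>) \<C>"
    unfolding mutation_pair_def by (intro conjI subcategory_D rigid C(1) N(1) ct(2) DN(1))
qed

end

theorem theorem5p3:
  fixes T :: "('k::field, 'o, 'm::ab_group_add, 'z) tri_cat_scheme"
    and S S' :: "('o, 'm) endofunctor"
    and \<D> :: "'o set"
  assumes "triangulated_category T" and "hom_finite T" and "krull_schmidt T"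
    and "serre_functor T S S'"
    and "almost_complete_two_cluster_tilting T S S' \<D>"
  shows "\<exists>\<X> \<Y>. \<X> \<noteq> \<Y> \<and>
    {\<C>. two_cluster_tilting T \<C> \<and> \<D> \<subseteq> \<C>} = {\<X>, \<Y>} \<and>
    mutation_pair T \<D> \<X> \<Y> \<and> mutation_pair T \<D> \<Y> \<X>"
proof -
  interpret triangulated_category T by (rule assms(1))
  have D: "functorially_finite T \<D>" "two_rigid T \<D>" "S2_subcategory T S S' \<D>"
    and "\<exists>\<C>. two_cluster_tilting T \<C> \<and> \<D> \<subseteq> \<C> \<and>
      (\<exists>X. indecomposable T X \<and> ind T \<C> - ind T \<D> = S2_orbit T S S' X)"
    using assms(5) unfolding almost_complete_two_cluster_tilting_def by blast+
  then obtain \<C> X where C: "two_cluster_tilting T \<C>" "\<D> \<subseteq> \<C>"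
    "ind T \<C> - ind T \<D> = S2_orbit T S S' X" "indecomposable T X" by blast
  have sub: "subcategory T \<D>" using D(3) unfolding S2_subcategory_def by blast
  \<comment> \<open>Stability of \<D> under S_2 identifies its two Ext-perpendiculars.\<close>
  interpret mutation_base T \<D>
    by unfold_locales
      (use sub D(1) D(2)[unfolded two_rigid_iff] S2_subcategory_ext_right[OF assms(4) D(3)] in blast)+
  show ?thesis
    using exactly_two_cluster_tilting[OF assms(2-4) C] by blast
qed

end
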